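(* Let $n\ge 6$ be an integer, $\alpha>0$, $k=-1$, and set $$r_0^2=2\alpha(n-4)(n-5),\qquad \Lambda=-\frac{n^2-5n-2}{8\alpha(n-4)(n-5)}.$$ Let $I\subset(0,\infty)$ be an open interval and consider on $\mathcal{M}^4\times\mathcal{K}^{n-4}$ the metric $g_{\mu\nu}=\mathrm{diag}(g_{AB},r_0^2\gamma_{ab})$, where $\gamma_{ab}$ is the metric of an $(n-4)$-dimensional space $\mathcal{K}^{n-4}$ of constant sectional curvature $-1$ and $$g_{AB}dx^Adx^B=-f(r)\,dt^2+\frac{1}{f(r)}\,dr^2+r^2d\Sigma^2,\qquad r\in I,$$ with $d\Sigma^2$ the metric of the unit two-sphere. Then the general solution $f$ of the scalar constraint equation $\mathcal{G}^a{}_b=0$ is $$f(r)=1+\frac{r^2}{2(n-4)\alpha}\left[1\mp\left\{1-\frac{2n-11}{3(n-5)}+\frac{4(n-4)^2\alpha^{3/2}M}{r^3}-\frac{4(n-4)^2\alpha^2 q}{r^4}\right\}^{1/2}\right],$$ where $M$ and $q$ are arbitrary real constants. That is: (a) for all real $M,q$ and either choice of sign, if the expression in braces is positive on $I$ then this $f$ satisfies $\mathcal{G}^a{}_b=0$ (wherever $f\ne0$); (b) conversely, if a $C^2$ nowhere vanishing function $f$ on $I$ satisfies $\mathcal{G}^a{}_b=0$, then there are real constants $M,q$ such that for every $r\in I$ the expression in braces is nonnegative and $$f(r)=1+\frac{r^2}{2(n-4)\alpha}\left[1\mp\left\{1-\frac{2n-11}{3(n-5)}+\frac{4(n-4)^2\alpha^{3/2}M}{r^3}-\frac{4(n-4)^2\alpha^2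 q}{r^4}\right\}^{1/2}\right]$$ with one of the two signs.
   Context: On an $n$-dimensional pseudo-Riemannian manifold with metric $g_{\mu\nu}$, define $$\mathcal{G}^\mu{}_\nu = G^\mu{}_\nu+\alpha H^\mu{}_\nu+\Lambda\,\delta^\mu{}_\nu,$$ where $G_{\mu\nu}=R_{\mu\nu}-\frac12 g_{\mu\nu}R$, $$H_{\mu\nu}=2\left[RR_{\mu\nu}-2R_{\mu\alpha}R^\alpha{}_\nu-2R^{\alpha\beta}R_{\mu\alpha\nu\beta}+R_\mu{}^{\alpha\beta\gamma}R_{\nu\alpha\beta\gamma}\right]-\frac12 g_{\mu\nu}L_{GB},$$ $$L_{GB}=R^2-4R_{\mu\nu}R^{\mu\nu}+R_{\mu\nu\rho\sigma}R^{\mu\nu\rho\sigma},$$ and $R_{\mu\nu\rho\sigma}$, $R_{\mu\nu}=R^\alpha{}_{\mu\alpha\nu}$, $R$ are the Riemann tensor, Ricci tensor and Ricci scalar of the $n$-dimensional metric (with signs such that round spheres have positive Ricci scalar). Indices $A,B\in\{0,1,2,3\}$ refer to $\mathcal{M}^4$; indices $a,b\in\{4,\dots,n-1\}$ refer to $\mathcal{K}^{n-4}$. For a product metric $\mathrm{diag}(g_{AB},r_0^2\gamma_{ab})$ with $\gamma_{ab}$ of constant curvature $k$, the components along $\mathcal{K}^{n-4}$ are $$\mathcal{G}^a{}_b=\delta^a{}_b\Big[-\tfrac12 R^{(4)}+\Lambda-\tfrac{(n-5)(n-6)k}{2r_0^2}-\alpha\Big\{\tfrac{k(n-5)(n-6)}{r_0^2}R^{(4)}+\tfrac12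 L^{(4)}_{GB}+\tfrac{(n-5)(n-6)(n-7)(n-8)k^2}{2r_0^4}\Big\}\Big],$$ where $R^{(4)}$ and $L^{(4)}_{GB}$ are the Ricci scalar and Gauss-Bonnet scalar of $g_{AB}$; so $\mathcal{G}^a{}_b=0$ is a single scalar equation on $\mathcal{M}^4$. *)

theory Defs
  imports "HOL-Analysis.Analysis"
begin

text \<open>
  Tensor calculus in a coordinate chart: a metric is a matrix-valued function of the
  coordinates, \<open>g x $ \<mu> $ \<nu>\<close> being the component with lower indices
  \<open>\<mu>\<close>, \<open>\<nu>\<close> at the point with coordinates \<open>x\<close>.
\<close>

type_synonym 'i metric = "real^'i \<Rightarrow> real^'i^'i"

definition partial :: "'i::finite \<Rightarrow> (real^'i \<Rightarrow> real) \<Rightarrow> real^'i \<Rightarrow> real" where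
  "partial i F x = deriv (\<lambda>s. F (x + s *\<^sub>R axis i 1)) 0"

fun Ck_on :: "nat \<Rightarrow> (real^'i::finite \<Rightarrow> real) \<Rightarrow> (real^'i) set \<Rightarrow> bool" where
  "Ck_on 0 F U \<longleftrightarrow> continuous_on U F"
| "Ck_on (Suc k) F U \<longleftrightarrow> F differentiable_on U \<and> (\<forall>i. Ck_on k (partial i F) U)"

definition C2_real_on :: "(real \<Rightarrow> real) \<Rightarrow> real set \<Rightarrow> bool" where
  "C2_real_on f I \<longleftrightarrow>
     f differentiable_on I \<and> deriv f differentiable_on I \<and> continuous_on I (deriv (deriv f))"

abbreviation ginv :: "'i::finite metric \<Rightarrow> 'i metric" where
  "ginv g x \<equiv> matrix_inv (g x)"

definition christoffel :: "'i::finite metric \<Rightarrow> 'i \<Rightarrow> 'i \<Rightarrow> 'i \<Rightarrow> real^'i \<Rightarrow> real" where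
  "christoffel g l m n x =
     (1/2) * (\<Sum>s\<in>UNIV. ginv g x $ l $ s *
        (partial m (\<lambda>y. g y $ s $ n) x + partial n (\<lambda>y. g y $ s $ m) x
          - partial s (\<lambda>y. g y $ m $ n) x))"

text \<open>\<open>riemann_up g r s m n\<close> is the component with first index \<open>r\<close> raised;
  the sign is the one for which round spheres have positive Ricci scalar.\<close>

definition riemann_up :: "'i::finite metric \<Rightarrow> 'i \<Rightarrow> 'i \<Rightarrow> 'i \<Rightarrow> 'i \<Rightarrow> real^'i \<Rightarrow> real" where
  "riemann_up g r s m n x =
     partial m (christoffel g r n s) x - partial n (christoffel g r m s) x
     + (\<Sum>l\<in>UNIV. christoffel g r m l x * christoffel g l n s x
                 - christoffel g r n l x * christoffel g l m s x)"

definition riemann :: "'i::finite metric \<Rightarrow> 'i \<Rightarrow> 'i \<Rightarrow> 'i \<Rightarrow> 'i \<Rightarrow> real^'i \<Rightarrow> real" where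
  "riemann g r s m n x = (\<Sum>l\<in>UNIV. g x $ r $ l * riemann_up g l s m n x)"

definition ricci :: "'i::finite metric \<Rightarrow> 'i \<Rightarrow> 'i \<Rightarrow> real^'i \<Rightarrow> real" where
  "ricci g m n x = (\<Sum>a\<in>UNIV. riemann_up g a m a n x)"

definition ricci_scalar :: "'i::finite metric \<Rightarrow> real^'i \<Rightarrow> real" where
  "ricci_scalar g x = (\<Sum>m\<in>UNIV. \<Sum>n\<in>UNIV. ginv g x $ m $ n * ricci g m n x)"

definition ricci_contra :: "'i::finite metric \<Rightarrow> 'i \<Rightarrow> 'i \<Rightarrow> real^'i \<Rightarrow> real" where
  "ricci_contra g a b x =
     (\<Sum>c\<in>UNIV. \<Sum>d\<in>UNIV. ginv g x $ a $ c * ginv g x $ b $ d * ricci g c d x)"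

text \<open>The Riemann tensor with the last three of its four indices raised.\<close>

definition riemann_contra3 :: "'i::finite metric \<Rightarrow> 'i \<Rightarrow> 'i \<Rightarrow> 'i \<Rightarrow> 'i \<Rightarrow> real^'i \<Rightarrow> real" where
  "riemann_contra3 g m a b c x =
     (\<Sum>a'\<in>UNIV. \<Sum>b'\<in>UNIV. \<Sum>c'\<in>UNIV.
        ginv g x $ a $ a' * ginv g x $ b $ b' * ginv g x $ c $ c' * riemann g m a' b' c' x)"

definition gauss_bonnet :: "'i::finite metric \<Rightarrow> real^'i \<Rightarrow> real" where
  "gauss_bonnet g x =
     (ricci_scalar g x)\<^sup>2
     - 4 * (\<Sum>m\<in>UNIV. \<Sum>n\<in>UNIV. ricci g m n x * ricci_contra g m n x)
     + (\<Sum>m\<in>UNIV. \<Sum>n\<in>UNIV. \<Sum>r\<in>UNIV. \<Sum>s\<in>UNIV.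
          riemann g m n r s x * (\<Sum>m'\<in>UNIV. ginv g x $ m $ m' * riemann_contra3 g m' n r s x))"

definition einstein_tensor :: "'i::finite metric \<Rightarrow> 'i \<Rightarrow> 'i \<Rightarrow> real^'i \<Rightarrow> real" where
  "einstein_tensor g m n x = ricci g m n x - (1/2) * g x $ m $ n * ricci_scalar g x"

definition gb_tensor :: "'i::finite metric \<Rightarrow> 'i \<Rightarrow> 'i \<Rightarrow> real^'i \<Rightarrow> real" where
  "gb_tensor g m n x =
     2 * (ricci_scalar g x * ricci g m n x
          - 2 * (\<Sum>a\<in>UNIV. \<Sum>b\<in>UNIV. ricci g m a x * ginv g x $ a $ b * ricci g b n x)
          - 2 * (\<Sum>a\<in>UNIV. \<Sum>b\<in>UNIV. ricci_contra g a b x * riemann g m a n b x)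
          + (\<Sum>a\<in>UNIV. \<Sum>b\<in>UNIV. \<Sum>c\<in>UNIV.
               riemann_contra3 g m a b c x * riemann g n a b c x))
     - (1/2) * g x $ m $ n * gauss_bonnet g x"

definition field_tensor :: "real \<Rightarrow> real \<Rightarrow> 'i::finite metric \<Rightarrow> 'i \<Rightarrow> 'i \<Rightarrow> real^'i \<Rightarrow> real" where
  "field_tensor \<alpha> \<Lambda> g m n x =
     (\<Sum>l\<in>UNIV. ginv g x $ m $ l * (einstein_tensor g l n x + \<alpha> * gb_tensor g l n x))
     + \<Lambda> * (if m = n then 1 else 0)"

definition riemannian_metric_on :: "'i::finite metric \<Rightarrow> (real^'i) set \<Rightarrow> bool" where
  "riemannian_metric_on \<gamma> U \<longleftrightarrow>
     (\<forall>a b. Ck_on 2 (\<lambda>x. \<gamma> x $ a $ b) U) \<and>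
     (\<forall>x\<in>U. transpose (\<gamma> x) = \<gamma> x \<and> (\<forall>v. v \<noteq> 0 \<longrightarrow> v \<bullet> (\<gamma> x *v v) > 0))"

definition sectional_curvature ::
    "'i::finite metric \<Rightarrow> real^'i \<Rightarrow> real^'i \<Rightarrow> real^'i \<Rightarrow> real" where
  "sectional_curvature \<gamma> x u v =
     (\<Sum>a\<in>UNIV. \<Sum>b\<in>UNIV. \<Sum>c\<in>UNIV. \<Sum>d\<in>UNIV.
        riemann \<gamma> a b c d x * u $ a * v $ b * u $ c * v $ d)
     / ((u \<bullet> (\<gamma> x *v u)) * (v \<bullet> (\<gamma> x *v v)) - (u \<bullet> (\<gamma> x *v v))\<^sup>2)"

definition constant_sectional_curvature_on ::
    "real \<Rightarrow> 'i::finite metric \<Rightarrow> (real^'i) set \<Rightarrow> bool" where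
  "constant_sectional_curvature_on k \<gamma> U \<longleftrightarrow>
     (\<forall>x\<in>U. \<forall>u v. u \<noteq> v \<and> independent {u, v} \<longrightarrow> sectional_curvature \<gamma> x u v = k)"

text \<open>
  The four-dimensional coordinates are \<open>(t, r, \<theta>, \<phi>)\<close>, numbered 0, 1, 2, 3
  by the numeral type \<open>4\<close>; the unit two-sphere is in spherical coordinates.
\<close>

definition static_metric :: "(real \<Rightarrow> real) \<Rightarrow> 4 metric" where
  "static_metric f x = (\<chi> A B.
     if A \<noteq> B then 0
     else if A = 0 then - f (x $ 1)
     else if A = 1 then 1 / f (x $ 1)
     else if A = 2 then (x $ 1)\<^sup>2
     else (x $ 1)\<^sup>2 * (sin (x $ 2))\<^sup>2)"

definition base_part :: "real^('a::finite + 'b::finite) \<Rightarrow> real^'a" where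
  "base_part x = (\<chi> A. x $ Inl A)"

definition fibre_part :: "real^('a::finite + 'b::finite) \<Rightarrow> real^'b" where
  "fibre_part x = (\<chi> a. x $ Inr a)"

text \<open>The metric \<open>diag(g\<^sub>A\<^sub>B, c \<gamma>\<^sub>a\<^sub>b)\<close>; \<open>c\<close> is the squared radius.\<close>

definition product_metric ::
    "'a::finite metric \<Rightarrow> real \<Rightarrow> 'b::finite metric \<Rightarrow> ('a + 'b) metric" where
  "product_metric g c \<gamma> x = (\<chi> m n.
     case (m, n) of
       (Inl A, Inl B) \<Rightarrow> g (base_part x) $ A $ B
     | (Inr a, Inr b) \<Rightarrow> c * \<gamma> (fibre_part x) $ a $ b
     | _ \<Rightarrow> 0)"

definition chart_domain :: "real set \<Rightarrow> (real^'m::finite) set \<Rightarrow> (real^(4 + 'm)) set" where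
  "chart_domain I U =
     {x. base_part x $ 1 \<in> I \<and> 0 < base_part x $ 2 \<and> base_part x $ 2 < pi \<and> fibre_part x \<in> U}"

definition fibre_constraint ::
    "real \<Rightarrow> real \<Rightarrow> ('a::finite + 'b::finite) metric \<Rightarrow> real^('a + 'b) \<Rightarrow> bool" where
  "fibre_constraint \<alpha> \<Lambda> g x \<longleftrightarrow> (\<forall>a b. field_tensor \<alpha> \<Lambda> g (Inr a) (Inr b) x = 0)"

definition braces :: "nat \<Rightarrow> real \<Rightarrow> real \<Rightarrow> real \<Rightarrow> real \<Rightarrow> real" where
  "braces n \<alpha> M q r =
     1 - (2 * real n - 11) / (3 * (real n - 5))
       + 4 * (real n - 4)\<^sup>2 * (\<alpha> powr (3/2)) * M / r ^ 3
       - 4 * (real n - 4)\<^sup>2 * \<alpha>\<^sup>2 * q / r ^ 4"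

text \<open>\<open>\<sigma> = -1\<close> and \<open>\<sigma> = 1\<close> are the upper and lower sign.\<close>

definition solution :: "nat \<Rightarrow> real \<Rightarrow> real \<Rightarrow> real \<Rightarrow> real \<Rightarrow> real \<Rightarrow> real" where
  "solution n \<alpha> M q \<sigma> r =
     1 + r\<^sup>2 / (2 * (real n - 4) * \<alpha>) * (1 + \<sigma> * sqrt (braces n \<alpha> M q r))"

end

(*
  For a product with a fibre of constant curvature, the Riemann tensor is block diagonal, so the
  fibre components of the field equation reduce to one scalar equation in the Ricci and
  Gauss-Bonnet scalars of the four-dimensional factor; polarization of the sectional curvature
  supplies the tensorial form of the fibre curvature. For the static metric both r^2 R and
  r^2 L_GB are second derivatives:
    r^2 R = 2 - (r^2 f)'',   r^2 L_GB = 2 ((1 - f)^2)''.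
  Multiplied by -2 r^2 the constraint therefore says P'' = 0 for a P that is quadratic in 1 - f.
  Its solutions P = A + B r are quadratic equations for f, with q = - A / (2 alpha) and
  M = B / (2 sqrt alpha).
*)
theory Submission
  imports Defs
begin

section \<open>Partial derivatives\<close>

text \<open>The values of \<open>r\<^sub>0\<^sup>2\<close> and \<Lambda> are those for which the
  field tensor along the four-dimensional factor vanishes identically: with m = n - 4, the radius 2
  \<alpha> m (m - 1) cancels the four-dimensional Einstein tensor, the Gauss-Bonnet tensor is zero
  in four dimensions, and \<Lambda> removes the remaining constant. So the scalar equation carries
  all the content. Two facts shape the work. \<open>partial\<close> is \<open>deriv\<close>, a
  choice operator, so no rule of calculus applies before differentiability is known. And the fibre
  metric is only C^2 and known only through sectional curvatures; turning these into a tensor needs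
  the symmetries of the Riemann tensor, hence equality of mixed partials and differentiability of
  the inverse metric. The static metric takes the opposite route: its Christoffel symbols are
  tabulated and every index case is computed.\<close>

lemma sum_UNIV_Plus:
  "sum F (UNIV :: ('a::finite + 'b::finite) set) = (\<Sum>A\<in>UNIV. F (Inl A)) + (\<Sum>a\<in>UNIV. F (Inr a))"
  by (simp add: sum.Plus flip: UNIV_Plus_UNIV)

text \<open>Stated at every point of the line, not only at \<open>s = 0\<close>, because the mean
  value theorem is later applied on a whole segment.\<close>

lemma has_partial_along_axis:
  fixes F :: "real^'i::finite \<Rightarrow> real"
  assumes "open U" "F differentiable_on U" "x + s *\<^sub>R axis i 1 \<in> U"
  shows "((\<lambda>s. F (x + s *\<^sub>R axis i 1)) has_real_derivative partial i F (x + s *\<^sub>R axis i 1)) (at s)"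
proof -
  let ?y = "x + s *\<^sub>R axis i 1"
  have "F differentiable (at ?y)"
    using assms differentiable_on_eq_differentiable_at by blast
  moreover have "(\<lambda>h. x + h *\<^sub>R axis i 1) differentiable (at s)"
    by (auto intro!: derivative_intros)
  ultimately have d: "(\<lambda>s. F (x + s *\<^sub>R axis i 1)) differentiable (at s)"
    using differentiable_chain_at[of "\<lambda>h. x + h *\<^sub>R axis i 1" s F] by (simp add: o_def)
  then obtain D where D: "((\<lambda>s. F (x + s *\<^sub>R axis i 1)) has_real_derivative D) (at s)"
    using real_differentiable_def by blast
  have "((\<lambda>h. F (x + (s + h) *\<^sub>R axis i 1)) has_real_derivative D) (at 0)"
    using DERIV_shift[of "\<lambda>s. F (x + s *\<^sub>R axis i 1)" D 0 s] D by (simp add: add.commute)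
  then have "partial i F ?y = D"
    unfolding partial_def by (intro DERIV_imp_deriv) (simp add: scaleR_add_left add.assoc)
  with D show ?thesis by simp
qed

lemma has_partial:
  fixes F :: "real^'i::finite \<Rightarrow> real"
  assumes "open U" "F differentiable_on U" "x \<in> U"
  shows "((\<lambda>s. F (x + s *\<^sub>R axis i 1)) has_real_derivative partial i F x) (at 0)"
  using has_partial_along_axis[of U F x 0 i] assms by simp

lemma partial_eqI:
  "((\<lambda>s. F (x + s *\<^sub>R axis i 1)) has_real_derivative D) (at 0) \<Longrightarrow> partial i F x = D"
  unfolding partial_def by (rule DERIV_imp_deriv)

lemma eventually_along_axis:
  fixes U :: "(real^'i::finite) set"
  assumes "open U" "x \<in> U"
  shows "eventually (\<lambda>s. x + s *\<^sub>R axis i 1 \<in> U) (nhds (0::real))"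
proof -
  have "((\<lambda>s. x + s *\<^sub>R axis i 1) \<longlongrightarrow> x + 0 *\<^sub>R axis i 1) (nhds (0::real))"
    by (intro tendsto_intros filterlim_ident)
  then show ?thesis
    using assms by (auto simp: tendsto_def)
qed

text \<open>A formula that holds only on an open chart domain can still be differentiated there: a
  coordinate line stays in the domain for small parameters.\<close>

lemma partial_cong:
  fixes U :: "(real^'i::finite) set"
  assumes "open U" "x \<in> U" "\<And>y. y \<in> U \<Longrightarrow> F y = G y"
  shows "partial i F x = partial i G x"
  unfolding partial_def
  by (rule deriv_cong_ev) (auto intro: eventually_mono[OF eventually_along_axis[OF assms(1,2)]] assms(3))

section \<open>Symmetry of second partial derivatives\<close>

lemma Clairaut_square:
  fixes F :: "real^'i::finite \<Rightarrow> real"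
  assumes U: "open U" and F: "F differentiable_on U" "partial i F differentiable_on U"
    and d: "0 < d" and sq: "\<And>s t. s \<in> {0..d} \<Longrightarrow> t \<in> {0..d} \<Longrightarrow> x + s *\<^sub>R axis i 1 + t *\<^sub>R axis j 1 \<in> U"
  obtains s t where "s \<in> {0..d}" "t \<in> {0..d}"
    "F (x + d *\<^sub>R axis i 1 + d *\<^sub>R axis j 1) - F (x + d *\<^sub>R axis i 1) - F (x + d *\<^sub>R axis j 1) + F x
      = d\<^sup>2 * partial j (partial i F) (x + s *\<^sub>R axis i 1 + t *\<^sub>R axis j 1)"
proof -
  \<comment> \<open>\<open>p s\<close> is the increment of \<open>F\<close> in direction
    \<open>j\<close> at offset \<open>s\<close>. The mean value theorem in direction
    \<open>i\<close> for \<open>p\<close>, then in direction \<open>j\<close> for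
    \<open>partial i F\<close>, produces the factor \<open>d\<^sup>2\<close>.\<close>
  define p where "p s = F ((x + d *\<^sub>R axis j 1) + s *\<^sub>R axis i 1) - F (x + s *\<^sub>R axis i 1)" for s
  have dp: "(p has_real_derivative
      (partial i F ((x + d *\<^sub>R axis j 1) + s *\<^sub>R axis i 1) - partial i F (x + s *\<^sub>R axis i 1))) (at s)"
    if "0 \<le> s" "s \<le> d" for s
    unfolding p_def using sq[of s 0] sq[of s d] that d
    by (intro DERIV_diff has_partial_along_axis[OF U F(1)]) (auto simp: algebra_simps)
  obtain s where s: "0 < s" "s < d" and ps: "p d - p 0 =
      (d - 0) * (partial i F ((x + d *\<^sub>R axis j 1) + s *\<^sub>R axis i 1) - partial i F (x + s *\<^sub>R axis i 1))"
    using MVT2[OF d dp] by blast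
  have dq: "((\<lambda>t. partial i F ((x + s *\<^sub>R axis i 1) + t *\<^sub>R axis j 1)) has_real_derivative
      partial j (partial i F) ((x + s *\<^sub>R axis i 1) + t *\<^sub>R axis j 1)) (at t)"
    if "0 \<le> t" "t \<le> d" for t
    using sq[of s t] that s by (intro has_partial_along_axis[OF U F(2)]) auto
  obtain t where t: "0 < t" "t < d" and
      qt: "partial i F ((x + s *\<^sub>R axis i 1) + d *\<^sub>R axis j 1) - partial i F ((x + s *\<^sub>R axis i 1) + 0 *\<^sub>R axis j 1) =
      (d - 0) * partial j (partial i F) ((x + s *\<^sub>R axis i 1) + t *\<^sub>R axis j 1)"
    using MVT2[OF d dq] by blast
  show ?thesis
  proof (rule that)
    show "s \<in> {0..d}" "t \<in> {0..d}" using s t by auto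
    have "F (x + d *\<^sub>R axis i 1 + d *\<^sub>R axis j 1) - F (x + d *\<^sub>R axis i 1) - F (x + d *\<^sub>R axis j 1) + F x = p d - p 0"
      unfolding p_def by (simp add: add_ac)
    then show "F (x + d *\<^sub>R axis i 1 + d *\<^sub>R axis j 1) - F (x + d *\<^sub>R axis i 1) - F (x + d *\<^sub>R axis j 1) + F x
      = d\<^sup>2 * partial j (partial i F) (x + s *\<^sub>R axis i 1 + t *\<^sub>R axis j 1)"
      using ps qt by (simp add: add_ac power2_eq_square)
  qed
qed

text \<open>The second difference of \<open>F\<close> over a small square is symmetric in the two
  directions, so the mixed partials in the two orders agree when taken at suitable points near
  \<open>x\<close>; continuity carries this to \<open>x\<close>.\<close>

lemma partial_commute:
  fixes F :: "real^'i::finite \<Rightarrow> real"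
  assumes U: "open U" and F: "Ck_on 2 F U" and x: "x \<in> U"
  shows "partial i (partial j F) x = partial j (partial i F) x"
proof -
  have F0: "F differentiable_on U" and F1: "\<And>i. partial i F differentiable_on U"
    and F2: "\<And>i j. continuous_on U (partial j (partial i F))"
    using F by (auto simp: numeral_2_eq_2)
  let ?G = "partial i (partial j F)" and ?H = "partial j (partial i F)"
  have cont: "isCont ?G x" "isCont ?H x"
    using F2 U x by (auto simp: continuous_on_eq_continuous_at)
  have "\<bar>?G x - ?H x\<bar> \<le> e" if e: "e > 0" for e
  proof -
    obtain d1 where d1: "d1 > 0" "\<And>y. dist y x < d1 \<Longrightarrow> \<bar>?G y - ?G x\<bar> < e/2"
      using cont(1) e by (auto simp: continuous_at_eps_delta dist_real_def dest!: spec[of _ "e/2"])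
    obtain d2 where d2: "d2 > 0" "\<And>y. dist y x < d2 \<Longrightarrow> \<bar>?H y - ?H x\<bar> < e/2"
      using cont(2) e by (auto simp: continuous_at_eps_delta dist_real_def dest!: spec[of _ "e/2"])
    obtain d3 where d3: "d3 > 0" "\<And>y. dist y x < d3 \<Longrightarrow> y \<in> U"
      using U x by (auto simp: open_dist)
    \<comment> \<open>Points of the square of side \<open>d\<close> lie within \<open>2 * d\<close>
      of \<open>x\<close>; a third of the least radius keeps them strictly inside all three
      balls.\<close>
    define d where "d = min d1 (min d2 d3) / 3"
    have d: "d > 0" "2 * d < d1" "2 * d < d2" "2 * d < d3"
      using d1 d2 d3 by (auto simp: d_def min_def)
    have near: "dist (x + s *\<^sub>R axis k 1 + t *\<^sub>R axis l 1) x \<le> 2 * d"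
      if "s \<in> {0..d}" "t \<in> {0..d}" for s t :: real and k l :: 'i
    proof -
      have "dist (x + s *\<^sub>R axis k 1 + t *\<^sub>R axis l 1) x = norm (s *\<^sub>R (axis k 1 :: real^'i) + t *\<^sub>R axis l 1)"
        by (simp add: dist_norm)
      also have "\<dots> \<le> \<bar>s\<bar> + \<bar>t\<bar>"
        by (rule order_trans[OF norm_triangle_ineq]) simp
      finally show ?thesis using that by auto
    qed
    have sq: "x + s *\<^sub>R axis k 1 + t *\<^sub>R axis l 1 \<in> U" if "s \<in> {0..d}" "t \<in> {0..d}" for s t k l
      using near[OF that] d d3(2) by (meson le_less_trans)
    obtain s t where st: "s \<in> {0..d}" "t \<in> {0..d}"
      and 1: "F (x + d *\<^sub>R axis i 1 + d *\<^sub>R axis j 1) - F (x + d *\<^sub>R axis i 1) - F (x + d *\<^sub>R axis j 1) + F x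
        = d\<^sup>2 * ?H (x + s *\<^sub>R axis i 1 + t *\<^sub>R axis j 1)"
      using Clairaut_square[OF U F0 F1[of i] d(1) sq] by blast
    obtain s' t' where st': "s' \<in> {0..d}" "t' \<in> {0..d}"
      and 2: "F (x + d *\<^sub>R axis j 1 + d *\<^sub>R axis i 1) - F (x + d *\<^sub>R axis j 1) - F (x + d *\<^sub>R axis i 1) + F x
        = d\<^sup>2 * ?G (x + s' *\<^sub>R axis j 1 + t' *\<^sub>R axis i 1)"
      using Clairaut_square[OF U F0 F1[of j] d(1) sq] by blast
    have "d\<^sup>2 * ?H (x + s *\<^sub>R axis i 1 + t *\<^sub>R axis j 1) = d\<^sup>2 * ?G (x + s' *\<^sub>R axis j 1 + t' *\<^sub>R axis i 1)"
      using 1 2 by (simp add: algebra_simps)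
    then have eq: "?H (x + s *\<^sub>R axis i 1 + t *\<^sub>R axis j 1) = ?G (x + s' *\<^sub>R axis j 1 + t' *\<^sub>R axis i 1)"
      using d(1) by simp
    have "\<bar>?H (x + s *\<^sub>R axis i 1 + t *\<^sub>R axis j 1) - ?H x\<bar> < e/2"
      using near[OF st] d by (intro d2) (meson le_less_trans)
    moreover have "\<bar>?G (x + s' *\<^sub>R axis j 1 + t' *\<^sub>R axis i 1) - ?G x\<bar> < e/2"
      using near[OF st'] d by (intro d1) (meson le_less_trans)
    ultimately show ?thesis using eq by linarith
  qed
  then show ?thesis
    using field_le_epsilon[of "\<bar>?G x - ?H x\<bar>" 0] by auto
qed

section \<open>Symmetries of the Riemann tensor\<close>

lemma matrix_inv_mult:
  fixes A :: "real^'i::finite^'i"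
  assumes "invertible A"
  shows "A ** matrix_inv A = mat 1" "matrix_inv A ** A = mat 1"
  using someI_ex[of "\<lambda>B. A ** B = mat 1 \<and> B ** A = mat 1"] assms
  unfolding invertible_def matrix_inv_def by blast+

lemma matrix_inv_entries:
  fixes A :: "real^'i::finite^'i"
  assumes "invertible A"
  shows "(\<Sum>k\<in>UNIV. A $ i $ k * matrix_inv A $ k $ j) = (if i = j then 1 else 0)"
    and "(\<Sum>k\<in>UNIV. matrix_inv A $ i $ k * A $ k $ j) = (if i = j then 1 else 0)"
  using matrix_inv_mult[OF assms] by (auto simp: matrix_matrix_mult_def mat_def vec_eq_iff)

lemma matrix_inv_unique:
  fixes A :: "real^'i::finite^'i"
  assumes "A ** B = mat 1"
  shows "invertible A" "matrix_inv A = B"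
proof -
  show i: "invertible A"
    using assms invertible_right_inverse by blast
  have "matrix_inv A = matrix_inv A ** (A ** B)" using assms by simp
  also have "\<dots> = B" using matrix_inv_mult[OF i] by (simp add: matrix_mul_assoc)
  finally show "matrix_inv A = B" .
qed

lemma matrix_inv_symmetric:
  fixes A :: "real^'i::finite^'i"
  assumes "invertible A" "transpose A = A"
  shows "matrix_inv A $ i $ j = matrix_inv A $ j $ i"
proof -
  have "transpose (matrix_inv A ** A) = mat 1"
    using matrix_inv_mult[OF assms(1)] by (simp add: transpose_mat)
  then have "A ** transpose (matrix_inv A) = mat 1"
    using assms(2) by (simp add: matrix_transpose_mul)
  then have "matrix_inv A = transpose (matrix_inv A)"
    by (rule matrix_inv_unique)
  then have "matrix_inv A $ i $ j = transpose (matrix_inv A) $ i $ j"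
    by (rule arg_cong)
  then show ?thesis by (simp add: transpose_def)
qed

text \<open>Exhibits the entries of the inverse as quotients of polynomials in the entries of
  \<open>A\<close>, the source of their differentiability.\<close>

lemma matrix_inv_Cramer:
  fixes A :: "real^'i::finite^'i"
  assumes "invertible A"
  shows "matrix_inv A $ k $ j = det (\<chi> i l. if l = k then (if i = j then 1 else 0) else A $ i $ l) / det A"
proof -
  have "A *v (\<chi> k. matrix_inv A $ k $ j) = (\<chi> i. if i = j then 1 else 0)"
    using matrix_inv_entries(1)[OF assms] by (simp add: vec_eq_iff matrix_vector_mult_def)
  then have "(\<chi> k. matrix_inv A $ k $ j) =
      (\<chi> k. det (\<chi> i l. if l = k then (\<chi> i. if i = j then 1 else 0) $ i else A $ i $ l) / det A)"
    using assms cramer invertible_det_nz by blast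
  then show ?thesis
    by (simp add: vec_eq_iff cong: if_cong)
qed

lemma differentiable_prod':
  fixes F :: "'a \<Rightarrow> real \<Rightarrow> real"
  assumes "finite S" "\<And>i. i \<in> S \<Longrightarrow> F i differentiable (at x)"
  shows "(\<lambda>s. \<Prod>i\<in>S. F i s) differentiable (at x)"
  using assms by (induction rule: finite_induct) auto

lemma differentiable_det:
  fixes A :: "real \<Rightarrow> real^'i::finite^'i"
  assumes "\<And>i j. (\<lambda>s. A s $ i $ j) differentiable (at x)"
  shows "(\<lambda>s. det (A s)) differentiable (at x)"
  unfolding det_def
  by (intro differentiable_sum differentiable_mult differentiable_prod' differentiable_const ballI assms)
     (auto simp: finite_permutations)

lemma differentiable_matrix_inv:
  fixes A :: "real \<Rightarrow> real^'i::finite^'i"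
  assumes A: "\<And>i j. (\<lambda>s. A s $ i $ j) differentiable (at x)"
    and inv: "eventually (\<lambda>s. invertible (A s)) (nhds x)"
  shows "(\<lambda>s. matrix_inv (A s) $ k $ j) differentiable (at x)"
proof -
  have "det (A x) \<noteq> 0"
    using eventually_nhds_x_imp_x[OF inv] by (simp add: invertible_det_nz)
  then have "(\<lambda>s. det (\<chi> i l. if l = k then (if i = j then 1 else 0) else A s $ i $ l) / det (A s))
      differentiable (at x)"
    by (intro differentiable_divide differentiable_det A) (rename_tac a b, case_tac "b = k", simp_all add: A)
  then obtain D where
    "((\<lambda>s. det (\<chi> i l. if l = k then (if i = j then 1 else 0) else A s $ i $ l) / det (A s))
      has_real_derivative D) (at x)"
    using real_differentiable_def by blast
  \<comment> \<open>Cramer's rule needs invertibility, so it identifies the two functions only near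
    \<open>x\<close>; that is enough for the derivative at \<open>x\<close>.\<close>
  moreover have ev: "eventually (\<lambda>s. det (\<chi> i l. if l = k then (if i = j then 1 else 0) else A s $ i $ l) / det (A s)
      = matrix_inv (A s) $ k $ j) (nhds x)"
    by (rule eventually_mono[OF inv]) (simp add: matrix_inv_Cramer)
  ultimately have "((\<lambda>s. matrix_inv (A s) $ k $ j) has_real_derivative D) (at x)"
    using DERIV_cong_ev[THEN iffD1, OF refl ev refl] by simp
  then show ?thesis using real_differentiable_def by blast
qed

lemma invertible_if_pos_def:
  fixes A :: "real^'i::finite^'i"
  assumes "\<And>v. v \<noteq> 0 \<Longrightarrow> v \<bullet> (A *v v) > 0"
  shows "invertible A"
proof -
  have "\<forall>v. A *v v = 0 \<longrightarrow> v = 0"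
    using assms by (metis inner_zero_right less_irrefl)
  then show ?thesis
    by (simp add: invertible_left_inverse matrix_left_invertible_ker)
qed

text \<open>Christoffel symbols of the first kind; the index \<open>s\<close> is the lowered one.\<close>

definition christoffel_lower :: "'i::finite metric \<Rightarrow> 'i \<Rightarrow> 'i \<Rightarrow> 'i \<Rightarrow> real^'i \<Rightarrow> real" where
  "christoffel_lower g s m n x =
     (partial m (\<lambda>y. g y $ s $ n) x + partial n (\<lambda>y. g y $ s $ m) x
          - partial s (\<lambda>y. g y $ m $ n) x) / 2"

lemma christoffel_eq:
  "christoffel g l m n x = (\<Sum>s\<in>UNIV. ginv g x $ l $ s * christoffel_lower g s m n x)"
  unfolding christoffel_def christoffel_lower_def by (simp add: sum_distrib_left)

section \<open>The Riemann tensor of a C^2 metric in coordinates\<close>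

locale C2_metric =
  fixes g :: "'i::finite metric" and U :: "(real^'i) set"
  assumes U: "open U"
    and C2: "Ck_on 2 (\<lambda>x. g x $ a $ b) U"
    and transp: "x \<in> U \<Longrightarrow> transpose (g x) = g x"
    and inv: "x \<in> U \<Longrightarrow> invertible (g x)"
begin

abbreviation D1 where "D1 m a b x \<equiv> partial m (\<lambda>y. g y $ a $ b) x"
abbreviation D2 where "D2 m n a b x \<equiv> partial m (partial n (\<lambda>y. g y $ a $ b)) x"

lemma sym: "x \<in> U \<Longrightarrow> g x $ a $ b = g x $ b $ a"
  by (drule transp, drule arg_cong[of _ _ "\<lambda>M. M $ b $ a"]) (simp add: transpose_def)

lemma D1_sym: "x \<in> U \<Longrightarrow> D1 m a b x = D1 m b a x"
  by (rule partial_cong[OF U]) (auto simp: sym)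

lemma D2_sym: "x \<in> U \<Longrightarrow> D2 m n a b x = D2 m n b a x"
  by (rule partial_cong[OF U]) (auto intro: D1_sym)

lemma D2_commute: "x \<in> U \<Longrightarrow> D2 m n a b x = D2 n m a b x"
  by (rule partial_commute[OF U C2])

lemma has_partial_g:
  assumes "x \<in> U"
  shows "((\<lambda>s. g (x + s *\<^sub>R axis m 1) $ a $ b) has_real_derivative D1 m a b x) (at 0)"
  using has_partial[OF U _ assms, of "\<lambda>x. g x $ a $ b"] C2 by (simp add: numeral_2_eq_2)

lemma has_partial_D1:
  assumes "x \<in> U"
  shows "((\<lambda>s. D1 n a b (x + s *\<^sub>R axis m 1)) has_real_derivative D2 m n a b x) (at 0)"
  using has_partial[OF U _ assms, of "partial n (\<lambda>x. g x $ a $ b)"] C2 by (simp add: numeral_2_eq_2)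

lemma has_partial_lower:
  assumes "x \<in> U"
  shows "((\<lambda>s. christoffel_lower g l a b (x + s *\<^sub>R axis m 1)) has_real_derivative
    (D2 m a l b x + D2 m b l a x - D2 m l a b x) / 2) (at 0)"
  unfolding christoffel_lower_def
  by (intro DERIV_cdivide DERIV_diff DERIV_add has_partial_D1 assms)

lemma lower_sym: "x \<in> U \<Longrightarrow> christoffel_lower g l a b x = christoffel_lower g l b a x"
  unfolding christoffel_lower_def by (simp add: D1_sym[of x _ a b])

lemma christoffel_sym: "x \<in> U \<Longrightarrow> christoffel g l a b x = christoffel g l b a x"
  unfolding christoffel_eq by (simp add: lower_sym[of x _ a b])

lemma lower_christoffel:
  assumes "x \<in> U"
  shows "(\<Sum>l\<in>UNIV. g x $ r $ l * christoffel g l m n x) = christoffel_lower g r m n x"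
proof -
  have "(\<Sum>l\<in>UNIV. g x $ r $ l * christoffel g l m n x)
      = (\<Sum>l\<in>UNIV. \<Sum>s\<in>UNIV. (g x $ r $ l * ginv g x $ l $ s) * christoffel_lower g s m n x)"
    by (simp add: christoffel_eq sum_distrib_left mult.assoc)
  also have "\<dots> = (\<Sum>s\<in>UNIV. (\<Sum>l\<in>UNIV. g x $ r $ l * ginv g x $ l $ s) * christoffel_lower g s m n x)"
    by (subst sum.swap) (simp add: sum_distrib_right)
  also have "\<dots> = christoffel_lower g r m n x"
    by (simp add: matrix_inv_entries inv[OF assms] if_distrib[of "\<lambda>z. z * _"] cong: if_cong)
  finally show ?thesis .
qed

text \<open>Metric compatibility of the Levi-Civita connection, in coordinates.\<close>

lemma D1_lower: "x \<in> U \<Longrightarrow> D1 m a b x = christoffel_lower g a m b x + christoffel_lower g b m a x"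
  unfolding christoffel_lower_def by (simp add: D1_sym[of x _ b a] D1_sym[of x _ m a] D1_sym[of x _ m b] field_simps)

text \<open>Supplies bare differentiability through Cramer's rule. The derivative of the inverse
  metric is never computed; \<open>partial_christoffel\<close> gets its effect from the lowered
  symbols.\<close>

lemma has_partial_christoffel:
  assumes x: "x \<in> U"
  shows "((\<lambda>s. christoffel g l a b (x + s *\<^sub>R axis m 1)) has_real_derivative
    partial m (christoffel g l a b) x) (at 0)"
proof -
  have 1: "(\<lambda>s. ginv g (x + s *\<^sub>R axis m 1) $ l $ k) differentiable (at 0)" for k
  proof (rule differentiable_matrix_inv)
    show "(\<lambda>s. g (x + s *\<^sub>R axis m 1) $ i $ j) differentiable (at 0)" for i j
      using has_partial_g[OF x] real_differentiable_def by blast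
    show "\<forall>\<^sub>F s in nhds 0. invertible (g (x + s *\<^sub>R axis m 1))"
      by (rule eventually_mono[OF eventually_along_axis[OF U x] inv])
  qed
  have 2: "(\<lambda>s. christoffel_lower g k a b (x + s *\<^sub>R axis m 1)) differentiable (at 0)" for k
    using has_partial_lower[OF x] real_differentiable_def by blast
  have "(\<lambda>s. christoffel g l a b (x + s *\<^sub>R axis m 1)) differentiable (at 0)"
    unfolding christoffel_eq by (intro differentiable_sum ballI differentiable_mult 1 2) auto
  then show ?thesis
    using real_differentiable_def partial_eqI by metis
qed

text \<open>Product rule applied to \<open>lower_christoffel\<close>: the lowered symbols contain no
  inverse metric, and their derivative is explicit in second derivatives of
  \<open>g\<close>.\<close>

lemma partial_christoffel:
  assumes x: "x \<in> U"
  shows "(\<Sum>l\<in>UNIV. g x $ r $ l * partial m (christoffel g l a b) x)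
    = (D2 m a r b x + D2 m b r a x - D2 m r a b x) / 2
      - (\<Sum>l\<in>UNIV. D1 m r l x * christoffel g l a b x)"
proof -
  have d: "((\<lambda>s. \<Sum>l\<in>UNIV. g (x + s *\<^sub>R axis m 1) $ r $ l * christoffel g l a b (x + s *\<^sub>R axis m 1))
     has_real_derivative (\<Sum>l\<in>UNIV. D1 m r l x * christoffel g l a b x
       + partial m (christoffel g l a b) x * g x $ r $ l)) (at 0)"
    using DERIV_mult[OF has_partial_g[OF x] has_partial_christoffel[OF x]]
    by (intro DERIV_sum) simp
  have ev: "\<forall>\<^sub>F s in nhds 0.
     (\<Sum>l\<in>UNIV. g (x + s *\<^sub>R axis m 1) $ r $ l * christoffel g l a b (x + s *\<^sub>R axis m 1))
     = christoffel_lower g r a b (x + s *\<^sub>R axis m 1)"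
    by (rule eventually_mono[OF eventually_along_axis[OF U x] lower_christoffel])
  have "((\<lambda>s. christoffel_lower g r a b (x + s *\<^sub>R axis m 1))
     has_real_derivative (\<Sum>l\<in>UNIV. D1 m r l x * christoffel g l a b x
       + partial m (christoffel g l a b) x * g x $ r $ l)) (at 0)"
    by (rule DERIV_cong_ev[THEN iffD1, OF refl ev refl d])
  from DERIV_unique[OF this has_partial_lower[OF x]] show ?thesis
    by (simp add: sum.distrib field_simps)
qed

text \<open>The inner product, in the metric, of the vectors with components
  \<open>christoffel g _ a b x\<close> and \<open>christoffel g _ c d x\<close>; hence the symmetry
  under exchange of the pairs in \<open>quad_sym\<close>.\<close>

definition quad :: "'i \<Rightarrow> 'i \<Rightarrow> 'i \<Rightarrow> 'i \<Rightarrow> real^'i \<Rightarrow> real" where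
  "quad a b c d x = (\<Sum>l\<in>UNIV. christoffel_lower g l a b x * christoffel g l c d x)"

lemma quad_sym:
  assumes "x \<in> U"
  shows "quad a b c d x = quad b a c d x" "quad a b c d x = quad a b d c x" "quad a b c d x = quad c d a b x"
proof -
  show "quad a b c d x = quad b a c d x" "quad a b c d x = quad a b d c x"
    unfolding quad_def by (simp_all add: lower_sym[OF assms, of _ a b] christoffel_sym[OF assms, of _ c d])
  have "quad a b c d x = (\<Sum>l\<in>UNIV. \<Sum>k\<in>UNIV. g x $ l $ k * christoffel g k a b x * christoffel g l c d x)"
    unfolding quad_def by (simp flip: lower_christoffel[OF assms] add: sum_distrib_right)
  also have "\<dots> = (\<Sum>k\<in>UNIV. \<Sum>l\<in>UNIV. g x $ k $ l * christoffel g l c d x * christoffel g k a b x)"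
    by (subst sum.swap) (simp add: sym[OF assms] mult_ac)
  also have "\<dots> = quad c d a b x"
    unfolding quad_def by (simp flip: lower_christoffel[OF assms] add: sum_distrib_right)
  finally show "quad a b c d x = quad c d a b x" .
qed

text \<open>The products of symbols in which \<open>r\<close> is the lowered index cancel against
  part of \<open>D1_lower\<close>, leaving only \<open>quad\<close> terms. Antisymmetry in the first
  pair and the Bianchi identity are then read off from the symmetries of \<open>D2\<close> and
  \<open>quad\<close>.\<close>

lemma riemann_formula:
  assumes x: "x \<in> U"
  shows "riemann g r s m n x = (D2 m s r n x - D2 m r n s x - D2 n s r m x + D2 n r m s x) / 2
     - quad m r n s x + quad n r m s x"
proof -
  have swap: "(\<Sum>k\<in>UNIV. g x $ r $ k * (\<Sum>l\<in>UNIV. christoffel g k a l x * christoffel g l b c x))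
      = (\<Sum>l\<in>UNIV. christoffel_lower g r a l x * christoffel g l b c x)" for a b c
    by (simp add: sum_distrib_left flip: lower_christoffel[OF x] mult.assoc)
       (subst sum.swap, simp add: sum_distrib_right)
  have split: "riemann g r s m n x =
      (\<Sum>l\<in>UNIV. g x $ r $ l * partial m (christoffel g l n s) x)
    - (\<Sum>l\<in>UNIV. g x $ r $ l * partial n (christoffel g l m s) x)
    + (\<Sum>k\<in>UNIV. g x $ r $ k * (\<Sum>l\<in>UNIV. christoffel g k m l x * christoffel g l n s x))
    - (\<Sum>k\<in>UNIV. g x $ r $ k * (\<Sum>l\<in>UNIV. christoffel g k n l x * christoffel g l m s x))"
    unfolding riemann_def riemann_up_def
    by (simp add: distrib_left right_diff_distrib sum.distrib sum_subtractf)
  have D1q: "(\<Sum>l\<in>UNIV. D1 a r l x * christoffel g l b c x)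
      = (\<Sum>l\<in>UNIV. christoffel_lower g r a l x * christoffel g l b c x) + quad a r b c x" for a b c
    unfolding quad_def by (simp add: D1_lower[OF x] sum.distrib distrib_right)
  show ?thesis
    unfolding split swap partial_christoffel[OF x] D1q
    \<comment> \<open>Equality of mixed partials removes the two second derivatives of the component
      \<open>g x $ r $ s\<close>.\<close>
    using D2_commute[OF x, of m n r s] by (simp add: field_simps)
qed

lemma riemann_antisym1: "x \<in> U \<Longrightarrow> riemann g r s m n x = - riemann g s r m n x"
  unfolding riemann_formula
  using quad_sym[of x m r n s] quad_sym[of x n r m s] quad_sym[of x n s m r] quad_sym[of x m s n r]
    D2_sym[of x m s r n] D2_sym[of x m r n s] D2_sym[of x n s r m] D2_sym[of x n r m s]
  by (simp add: field_simps)

lemma riemann_antisym2: "riemann g r s m n x = - riemann g r s n m x"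
  unfolding riemann_def riemann_up_def
  by (simp add: sum_subtractf algebra_simps flip: sum_negf sum.distrib)

lemma riemann_Bianchi:
  assumes x: "x \<in> U"
  shows "riemann g r s m n x + riemann g r m n s x + riemann g r n s m x = 0"
  unfolding riemann_formula[OF x]
  using D2_commute[OF x, of m s r n] D2_commute[OF x, of n s r m] D2_commute[OF x, of m n r s]
    D2_sym[OF x, of n r m s] D2_sym[OF x, of m r n s] D2_sym[OF x, of s r n m]
    quad_sym(2)[OF x, of m r n s] quad_sym(2)[OF x, of n r m s] quad_sym(2)[OF x, of s r m n]
  by (simp add: field_simps)

end

section \<open>Algebraic curvature tensors\<close>

lemma curvature_pair_symmetry:
  fixes T :: "'i \<Rightarrow> 'i \<Rightarrow> 'i \<Rightarrow> 'i \<Rightarrow> real"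
  assumes "\<And>a b c d. T a b c d = - T b a c d" "\<And>a b c d. T a b c d = - T a b d c"
    and "\<And>a b c d. T a b c d + T a c d b + T a d b c = 0"
  shows "T a b c d = T c d a b"
proof -
  \<comment> \<open>The Bianchi identities led by \<open>a\<close> and \<open>b\<close> give two
    expressions for \<open>T a b c d\<close>, those led by \<open>c\<close> and \<open>d\<close> two
    for \<open>T c d a b\<close>; both pairs have the same sum.\<close>
  have "T a b c d + T a c d b + T a d b c = 0" "T b c d a + T b d a c + T b a c d = 0"
    "T c d a b + T c a b d + T c b d a = 0" "T d a b c + T d b c a + T d c a b = 0"
    by (rule assms(3))+
  moreover have "T b a c d = - T a b c d" "T d c a b = - T c d a b" 
    "T a c d b = T c a b d" "T b c d a = T c b a d" "T c b d a = - T c b a d"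
    "T a d b c = T d a c b" "T d a b c = - T d a c b"
    "T b d a c = - T d b a c"  "T d b c a = - T d b a c"
    using assms(1,2) by (metis minus_minus)+
  ultimately show ?thesis by linarith
qed

text \<open>A tensor with these symmetries is determined by its biquadratic form, that is, by
  sectional curvatures. It is applied to the difference between the fibre curvature and its
  constant-curvature model.\<close>

lemma curvature_like_eq_0:
  fixes T :: "'i::finite \<Rightarrow> 'i \<Rightarrow> 'i \<Rightarrow> 'i \<Rightarrow> real"
  assumes anti: "\<And>a b c d. T a b c d = - T b a c d" "\<And>a b c d. T a b c d = - T a b d c"
    and Bianchi: "\<And>a b c d. T a b c d + T a c d b + T a d b c = 0"
    and zero: "\<And>u v :: real^'i. (\<Sum>a\<in>UNIV. \<Sum>b\<in>UNIV. \<Sum>c\<in>UNIV. \<Sum>d\<in>UNIV.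
        T a b c d * u $ a * v $ b * u $ c * v $ d) = 0"
  shows "T a b c d = 0"
proof -
  define B where "B u v w z = (\<Sum>a\<in>UNIV. \<Sum>b\<in>UNIV. \<Sum>c\<in>UNIV. \<Sum>d\<in>UNIV.
        T a b c d * u $ a * v $ b * w $ c * z $ d)" for u v w z :: "real^'i"
  have add: "B (u + u') v w z = B u v w z + B u' v w z" "B u (v + v') w z = B u v w z + B u v' w z"
    "B u v (w + w') z = B u v w z + B u v w' z" "B u v w (z + z') = B u v w z + B u v w z'"
    for u u' v v' w w' z z'
    unfolding B_def by (simp_all add: algebra_simps sum.distrib)
  have B_axis: "B (axis a 1) (axis b 1) (axis c 1) (axis d 1) = T a b c d" for a b c d
    unfolding B_def axis_def
    by (simp add: if_distrib[of "\<lambda>z. _ * z"] sum.delta cong: if_cong)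
  have B0: "B u v u v = 0" for u v
    using zero unfolding B_def by blast
  have pair: "T a b c d = T c d a b" for a b c d
    by (rule curvature_pair_symmetry[OF anti Bianchi])
  \<comment> \<open>inclusion-exclusion isolates the part of \<open>B u v u v\<close> that is linear in each of the four vectors\<close>
  have polar: "T a b c d = - T c b a d" for a b c d
  proof -
    let ?e = "\<lambda>i. axis i 1 :: real^'i"
    have "B (?e a + ?e c) (?e b + ?e d) (?e a + ?e c) (?e b + ?e d) = 0"
      "B (?e a) (?e b + ?e d) (?e a) (?e b + ?e d) = 0" "B (?e c) (?e b + ?e d) (?e c) (?e b + ?e d) = 0"
      "B (?e a + ?e c) (?e b) (?e a + ?e c) (?e b) = 0" "B (?e a + ?e c) (?e d) (?e a + ?e c) (?e d) = 0"
      "B (?e a) (?e b) (?e a) (?e b) = 0" "B (?e a) (?e d) (?e a) (?e d) = 0"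
      "B (?e c) (?e b) (?e c) (?e b) = 0" "B (?e c) (?e d) (?e c) (?e d) = 0"
      by (rule B0)+
    then have "T a b c d + T c b a d + T a d c b + T c d a b = 0"
      unfolding add B_axis by linarith
    then show ?thesis
      using pair[of a d c b] pair[of c d a b] by linarith
  qed
  \<comment> \<open>With antisymmetry in the first and third slots, \<open>T\<close> is invariant
    under cyclic shifts of its last three indices, so the Bianchi sum is
    \<open>3 * T a b c d\<close>.\<close>
  have "T a c d b = T a b c d"
    using pair anti polar by (metis minus_minus)
  moreover have "T a d b c = T a b c d"
    using pair anti polar by (metis minus_minus)
  ultimately show ?thesis
    using Bianchi[of a b c d] by linarith
qed

section \<open>Spaces of constant curvature\<close>

lemma independent_pairD:
  fixes u v :: "'a::real_vector"
  assumes "\<not> (u \<noteq> v \<and> independent {u, v})"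
  shows "u = 0 \<or> (\<exists>c. v = c *\<^sub>R u)"
proof (cases "u = v")
  case True
  then show ?thesis by (auto intro!: exI[of _ 1])
next
  case False
  with assms have "dependent {v, u}" by (simp add: insert_commute)
  then have "u = 0 \<or> v \<in> span {u}"
    using False independent_insert[of v "{u}"] by (auto simp: dependent_single)
  then show ?thesis by (auto simp: span_singleton)
qed

text \<open>For symmetric \<open>G\<close> the right side is the denominator of
  \<open>sectional_curvature\<close>, so the model tensor has sectional curvature one.\<close>

lemma curvature_form_Gram:
  fixes G :: "real^'i::finite^'i"
  shows "(\<Sum>a\<in>UNIV. \<Sum>b\<in>UNIV. \<Sum>c\<in>UNIV. \<Sum>d\<in>UNIV.
      (G $ a $ c * G $ b $ d - G $ a $ d * G $ b $ c) * u $ a * v $ b * u $ c * v $ d)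
    = (u \<bullet> (G *v u)) * (v \<bullet> (G *v v)) - (u \<bullet> (G *v v)) * (v \<bullet> (G *v u))"
proof -
  have "(\<Sum>a\<in>UNIV. \<Sum>b\<in>UNIV. \<Sum>c\<in>UNIV. \<Sum>d\<in>UNIV.
      (G $ a $ c * G $ b $ d - G $ a $ d * G $ b $ c) * u $ a * v $ b * u $ c * v $ d)
    = (\<Sum>a\<in>UNIV. \<Sum>b\<in>UNIV. \<Sum>c\<in>UNIV. \<Sum>d\<in>UNIV.
      (u $ a * v $ b) * ((G $ a $ c * u $ c) * (G $ b $ d * v $ d)))
    - (\<Sum>a\<in>UNIV. \<Sum>b\<in>UNIV. \<Sum>c\<in>UNIV. \<Sum>d\<in>UNIV.
      (u $ a * v $ b) * ((G $ b $ c * u $ c) * (G $ a $ d * v $ d)))"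
    by (simp add: algebra_simps flip: sum_subtractf)
  also have "\<dots> = (\<Sum>a\<in>UNIV. \<Sum>b\<in>UNIV. (u $ a * v $ b) * ((G *v u) $ a * (G *v v) $ b))
    - (\<Sum>a\<in>UNIV. \<Sum>b\<in>UNIV. (u $ a * v $ b) * ((G *v u) $ b * (G *v v) $ a))"
    by (simp add: matrix_vector_mult_def sum_product flip: sum_distrib_left)
  also have "\<dots> = (\<Sum>a\<in>UNIV. \<Sum>b\<in>UNIV. (u $ a * (G *v u) $ a) * (v $ b * (G *v v) $ b))
    - (\<Sum>a\<in>UNIV. \<Sum>b\<in>UNIV. (u $ a * (G *v v) $ a) * (v $ b * (G *v u) $ b))"
    by (simp add: mult_ac)
  also have "\<dots> = (u \<bullet> (G *v u)) * (v \<bullet> (G *v v)) - (u \<bullet> (G *v v)) * (v \<bullet> (G *v u))"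
    by (simp add: inner_vec_def sum_product)
  finally show ?thesis .
qed

lemma C2_metric_riemannian:
  assumes "open U" "riemannian_metric_on \<gamma> U"
  shows "C2_metric \<gamma> U"
proof
  show "open U" by fact
  show "Ck_on 2 (\<lambda>x. \<gamma> x $ a $ b) U" for a b
    using assms(2) unfolding riemannian_metric_on_def by blast
  show "transpose (\<gamma> x) = \<gamma> x" "invertible (\<gamma> x)" if "x \<in> U" for x
    using assms(2) that unfolding riemannian_metric_on_def by (auto intro: invertible_if_pos_def)
qed

lemma constant_curvature_riemann:
  assumes "C2_metric \<gamma> U" and K: "constant_sectional_curvature_on k \<gamma> U" and k: "k \<noteq> 0" and x: "x \<in> U"
  shows "riemann \<gamma> a b c d x = k * (\<gamma> x $ a $ c * \<gamma> x $ b $ d - \<gamma> x $ a $ d * \<gamma> x $ b $ c)"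
proof -
  interpret C2_metric \<gamma> U by fact
  define T where "T a b c d = riemann \<gamma> a b c d x
    - k * (\<gamma> x $ a $ c * \<gamma> x $ b $ d - \<gamma> x $ a $ d * \<gamma> x $ b $ c)" for a b c d
  have anti: "T a b c d = - T b a c d" "T a b c d = - T a b d c" for a b c d
    using riemann_antisym1[OF x, of a b c d] riemann_antisym2[of a b c d x]
    unfolding T_def by (simp_all add: algebra_simps)
  have "T a b c d = 0"
  proof (rule curvature_like_eq_0[where T = T, OF anti])
    show "T a b c d + T a c d b + T a d b c = 0" for a b c d
      using riemann_Bianchi[OF x, of a b c d] sym[OF x, of b c] sym[OF x, of b d] sym[OF x, of c d]
      unfolding T_def by (simp add: algebra_simps)
  next
    fix u v :: "real^'a"
    let ?S = "\<lambda>T. \<Sum>a\<in>UNIV. \<Sum>b\<in>UNIV. \<Sum>c\<in>UNIV. \<Sum>d\<in>UNIV. T a b c d * u $ a * v $ b * u $ c * v $ d :: real"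
    show "?S T = 0"
    proof (cases "u \<noteq> v \<and> independent {u, v}")
      case True
      have "v \<bullet> (\<gamma> x *v u) = u \<bullet> (\<gamma> x *v v)"
        using transp[OF x] by (metis dot_lmul_matrix inner_commute vector_transpose_matrix)
      then have Gram: "?S (\<lambda>a b c d. \<gamma> x $ a $ c * \<gamma> x $ b $ d - \<gamma> x $ a $ d * \<gamma> x $ b $ c)
         = (u \<bullet> (\<gamma> x *v u)) * (v \<bullet> (\<gamma> x *v v)) - (u \<bullet> (\<gamma> x *v v))\<^sup>2" (is "_ = ?den")
        using curvature_form_Gram[of "\<gamma> x" u v] by (simp add: power2_eq_square)
      have "?S (\<lambda>a b c d. riemann \<gamma> a b c d x) / ?den = k"
        using K x True unfolding constant_sectional_curvature_on_def sectional_curvature_def by blast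
      \<comment> \<open>Division by zero yields \<open>0\<close>, which \<open>k\<close> is not;
        hence the Gram determinant is nonzero and can be cleared.\<close>
      then have "?S (\<lambda>a b c d. riemann \<gamma> a b c d x) = k * ?den"
        using k by (cases "?den = 0") (auto simp: field_simps)
      moreover have "?S T = ?S (\<lambda>a b c d. riemann \<gamma> a b c d x)
         - k * ?S (\<lambda>a b c d. \<gamma> x $ a $ c * \<gamma> x $ b $ d - \<gamma> x $ a $ d * \<gamma> x $ b $ c)"
        unfolding T_def by (simp add: sum_distrib_left algebra_simps flip: sum_subtractf)
      ultimately show ?thesis using Gram by simp
    next
      case False
      then consider "u = 0" | r where "v = r *\<^sub>R u"
        using independent_pairD by blast
      then show ?thesis
      proof cases
        case 2
        \<comment> \<open>For proportional vectors, exchanging the first two summation indices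
          changes only the sign of \<open>T\<close>, so the sum equals its own negative.\<close>
        have "?S T = (\<Sum>a\<in>UNIV. \<Sum>b\<in>UNIV. \<Sum>c\<in>UNIV. \<Sum>d\<in>UNIV. T b a c d * u $ b * v $ a * u $ c * v $ d)"
          by (rule sum.swap)
        also have "\<dots> = - ?S T"
          unfolding 2 by (subst anti(1)) (simp add: mult_ac flip: sum_negf)
        finally show ?thesis by simp
      qed simp
    qed
  qed
  then show ?thesis unfolding T_def by simp
qed

section \<open>Rescaling a metric by a constant\<close>

lemma matrix_inv_scaleR:
  fixes A :: "real^'i::finite^'i"
  assumes "invertible A" "c \<noteq> 0"
  shows "invertible (c *\<^sub>R A)" "matrix_inv (c *\<^sub>R A) = (1/c) *\<^sub>R matrix_inv A"
proof -
  have "(c *\<^sub>R A) ** ((1/c) *\<^sub>R matrix_inv A) = mat 1"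
    using matrix_inv_mult(1)[OF assms(1)] assms(2)
    by (simp add: vec_eq_iff matrix_matrix_mult_def)
  then show "invertible (c *\<^sub>R A)" "matrix_inv (c *\<^sub>R A) = (1/c) *\<^sub>R matrix_inv A"
    by (rule matrix_inv_unique)+
qed

context C2_metric
begin

text \<open>The factor \<open>c\<close> from the derivatives cancels \<open>1 / c\<close> from the
  inverse; the curvature with one raised index is therefore unchanged, and the lowered tensor scales
  like \<open>c\<close>.\<close>

lemma christoffel_scaleR:
  assumes "x \<in> U" "c \<noteq> 0"
  shows "christoffel (\<lambda>x. c *\<^sub>R g x) l m n x = christoffel g l m n x"
proof -
  have "partial m (\<lambda>y. c * g y $ a $ b) x = c * D1 m a b x" for m a b
    by (rule partial_eqI) (intro DERIV_cmult has_partial_g assms)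
  then have "christoffel (\<lambda>x. c *\<^sub>R g x) l m n x =
     (1/2) * (\<Sum>s\<in>UNIV. (1 / c) * ginv g x $ l $ s * (c * (D1 m s n x + D1 n s m x - D1 s m n x)))"
    unfolding christoffel_def using matrix_inv_scaleR[OF inv[OF assms(1)] assms(2)]
    by (simp add: algebra_simps)
  then show ?thesis
    unfolding christoffel_def using assms(2) by simp
qed

lemma riemann_up_scaleR:
  assumes "x \<in> U" "c \<noteq> 0"
  shows "riemann_up (\<lambda>x. c *\<^sub>R g x) r s m n x = riemann_up g r s m n x"
proof -
  have "partial m (christoffel (\<lambda>x. c *\<^sub>R g x) l a b) x = partial m (christoffel g l a b) x" for m l a b
    by (rule partial_cong[OF U assms(1)]) (simp add: christoffel_scaleR assms(2))
  then show ?thesis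
    unfolding riemann_up_def by (simp add: christoffel_scaleR assms)
qed

lemma riemann_scaleR:
  assumes "x \<in> U" "c \<noteq> 0"
  shows "riemann (\<lambda>x. c *\<^sub>R g x) r s m n x = c * riemann g r s m n x"
  unfolding riemann_def by (simp add: riemann_up_scaleR assms sum_distrib_left mult.assoc)

end

text \<open>Formulated at a single point, since the Ricci, Gauss-Bonnet and field tensors are
  algebraic in the metric and the Riemann tensor. \<open>N\<close> is real so that polynomials in
  the dimension avoid subtraction of natural numbers.\<close>

locale space_form_at =
  fixes h :: "'b::finite metric" and x :: "real^'b" and \<kappa> N :: real
  assumes N: "N = real CARD('b)"
    and transp: "transpose (h x) = h x" and inv: "invertible (h x)"
    and riem: "riemann h a b c d x = \<kappa> * (h x $ a $ c * h x $ b $ d - h x $ a $ d * h x $ b $ c)"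
begin

lemma sym: "h x $ a $ b = h x $ b $ a"
  using arg_cong[OF transp, of "\<lambda>M. M $ b $ a"] by (simp add: transpose_def)

lemma ginv_sym: "ginv h x $ a $ b = ginv h x $ b $ a"
  by (rule matrix_inv_symmetric[OF inv transp])

lemma contract:
  "(\<Sum>k\<in>UNIV. h x $ i $ k * ginv h x $ k $ j) = (if i = j then 1 else 0)"
  "(\<Sum>k\<in>UNIV. ginv h x $ i $ k * h x $ k $ j) = (if i = j then 1 else 0)"
  "(\<Sum>k\<in>UNIV. h x $ k $ i * ginv h x $ k $ j) = (if i = j then 1 else 0)"
  "(\<Sum>k\<in>UNIV. h x $ k $ i * ginv h x $ j $ k) = (if i = j then 1 else 0)"
  "(\<Sum>k\<in>UNIV. h x $ i $ k * ginv h x $ j $ k) = (if i = j then 1 else 0)"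
  using matrix_inv_entries[OF inv] by (auto simp: sym[of _ i] ginv_sym[of j] mult.commute)

lemma riemann_up_eq:
  "riemann_up h r s m n x
    = \<kappa> * ((if r = m then h x $ s $ n else 0) - (if r = n then h x $ s $ m else 0))"
proof -
  \<comment> \<open>The product of the inverse metric and the metric is inserted to reach the
    lowered tensor, which is the one known by \<open>riem\<close>.\<close>
  have "riemann_up h r s m n x = (\<Sum>l\<in>UNIV. (\<Sum>k\<in>UNIV. ginv h x $ r $ k * h x $ k $ l) * riemann_up h l s m n x)"
    by (simp add: contract if_distrib[of "\<lambda>z. z * _"] cong: if_cong)
  also have "\<dots> = (\<Sum>k\<in>UNIV. ginv h x $ r $ k * riemann h k s m n x)"
    unfolding riemann_def by (simp add: sum_distrib_left sum_distrib_right mult.assoc) (rule sum.swap)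
  also have "\<dots> = \<kappa> * ((\<Sum>k\<in>UNIV. ginv h x $ r $ k * h x $ k $ m) * h x $ s $ n
      - (\<Sum>k\<in>UNIV. ginv h x $ r $ k * h x $ k $ n) * h x $ s $ m)"
    unfolding riem by (simp add: sum_distrib_left sum_distrib_right algebra_simps flip: sum_subtractf)
  finally show ?thesis by (simp add: contract)
qed

lemma ricci_eq: "ricci h a b x = \<kappa> * (N - 1) * h x $ a $ b"
  unfolding ricci_def riemann_up_eq N
  by (simp add: sum_subtractf algebra_simps flip: sum_distrib_left)

lemma ricci_scalar_eq: "ricci_scalar h x = \<kappa> * N * (N - 1)"
proof -
  have "ricci_scalar h x = \<kappa> * (N - 1) * (\<Sum>a\<in>UNIV. \<Sum>b\<in>UNIV. ginv h x $ a $ b * h x $ b $ a)"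
    unfolding ricci_scalar_def ricci_eq by (simp add: sum_distrib_left sym mult_ac)
  then show ?thesis by (simp add: contract N)
qed

lemma ricci_contra_eq: "ricci_contra h a b x = \<kappa> * (N - 1) * ginv h x $ a $ b"
proof -
  have "ricci_contra h a b x =
     \<kappa> * (N - 1) * (\<Sum>c\<in>UNIV. ginv h x $ a $ c * (\<Sum>d\<in>UNIV. h x $ c $ d * ginv h x $ b $ d))"
    unfolding ricci_contra_def ricci_eq by (simp add: sum_distrib_left mult_ac)
  then show ?thesis
    by (simp add: contract if_distrib[of "\<lambda>z. _ * z"] cong: if_cong)
qed

lemma riemann_contra3_eq:
  "riemann_contra3 h r a b c x =
     \<kappa> * ((if r = b then ginv h x $ a $ c else 0) - (if r = c then ginv h x $ a $ b else 0))"
proof -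
  let ?d = "\<lambda>i j. if i = j then 1 else 0 :: real"
  \<comment> \<open>Contractions are done one raised index at a time, from the innermost sum
    outwards; \<open>1\<close> and \<open>2\<close> have the exact shapes that appear.\<close>
  have 1: "(\<Sum>k\<in>UNIV. ginv h x $ c $ k * (p * h x $ i $ k - q * h x $ j $ k)) = p * ?d i c - q * ?d j c"
    for c i j p q
    using contract(5)[of i c] contract(5)[of j c]
    by (simp add: algebra_simps sum_subtractf flip: sum_distrib_left)
  have 2: "(\<Sum>k\<in>UNIV. ginv h x $ b $ k * (h x $ i $ k * p - h x $ j $ k * q)) = p * ?d i b - q * ?d j b"
    for b i j p q
    using 1[of b p i q j] by (simp only: mult.commute)
  have "riemann_contra3 h r a b c x = (\<Sum>a'\<in>UNIV. \<Sum>b'\<in>UNIV. ginv h x $ a $ a' * (\<kappa> * (ginv h x $ b $ b' *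
     (\<Sum>c'\<in>UNIV. ginv h x $ c $ c' * (h x $ r $ b' * h x $ a' $ c' - h x $ a' $ b' * h x $ r $ c')))))"
    unfolding riemann_contra3_def riem by (simp add: sum_distrib_left mult_ac)
  also have "\<dots> = (\<Sum>a'\<in>UNIV. ginv h x $ a $ a' * (\<kappa> *
     (\<Sum>b'\<in>UNIV. ginv h x $ b $ b' * (h x $ r $ b' * ?d a' c - h x $ a' $ b' * ?d r c))))"
    unfolding 1 sum_distrib_left ..
  also have "\<dots> = \<kappa> * ((if r = b then ginv h x $ a $ c else 0) - (if r = c then ginv h x $ a $ b else 0))"
    unfolding 2 by (simp add: right_diff_distrib sum_subtractf mult.left_commute[of _ \<kappa>]
        if_distrib[of "\<lambda>z. _ * z"] flip: sum_distrib_left cong: if_cong)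
  finally show ?thesis .
qed

end

text \<open>Serves the square of the Riemann tensor in \<open>gb_tensor\<close>, where one factor is
  an antisymmetrised Kronecker delta.\<close>

lemma sum_delta_antisym:
  fixes F :: "'b::finite \<Rightarrow> 'b \<Rightarrow> real"
  shows "(\<Sum>d\<in>UNIV. \<Sum>e\<in>UNIV. ((if a = d then p e else 0) - (if a = e then p d else 0)) * F d e)
    = (\<Sum>e\<in>UNIV. p e * F a e) - (\<Sum>d\<in>UNIV. p d * F d a)"
proof -
  have "(\<Sum>d\<in>UNIV. \<Sum>e\<in>UNIV. (if a = d then p e else 0) * F d e) = (\<Sum>e\<in>UNIV. p e * F a e)"
    by (subst sum.swap) (simp add: if_distrib[of "\<lambda>z. z * _"] cong: if_cong)
  moreover have "(\<Sum>d\<in>UNIV. \<Sum>e\<in>UNIV. (if a = e then p d else 0) * F d e) = (\<Sum>d\<in>UNIV. p d * F d a)"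
    by (simp add: if_distrib[of "\<lambda>z. z * _"] cong: if_cong)
  ultimately show ?thesis
    by (simp add: left_diff_distrib sum_subtractf)
qed

context space_form_at
begin

lemma ginv_h_sum: "(\<Sum>a\<in>UNIV. \<Sum>b\<in>UNIV. h x $ a $ b * ginv h x $ a $ b) = N"
  using contract(5) by (simp add: N)

text \<open>In units of \<open>\<kappa>\<^sup>2 * N * (N - 1)\<close> the three terms contribute
  \<open>N * (N - 1)\<close>, \<open>- 4 * (N - 1)\<close> and \<open>2\<close>, whose sum is
  \<open>(N - 2) * (N - 3)\<close>.\<close>

lemma gauss_bonnet_eq: "gauss_bonnet h x = \<kappa>\<^sup>2 * N * (N - 1) * (N - 2) * (N - 3)"
proof -
  let ?d = "\<lambda>i j. if i = j then 1 else 0 :: real"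
  have 1: "(\<Sum>a\<in>UNIV. \<Sum>b\<in>UNIV. ricci h a b x * ricci_contra h a b x) = (\<kappa> * (N - 1))\<^sup>2 * N"
  proof -
    have "(\<Sum>a\<in>UNIV. \<Sum>b\<in>UNIV. ricci h a b x * ricci_contra h a b x)
       = (\<kappa> * (N - 1))\<^sup>2 * (\<Sum>a\<in>UNIV. \<Sum>b\<in>UNIV. h x $ a $ b * ginv h x $ a $ b)"
      unfolding ricci_eq ricci_contra_eq sum_distrib_left by (simp add: power2_eq_square mult_ac)
    then show ?thesis by (simp add: ginv_h_sum)
  qed
  have c4: "(\<Sum>r'\<in>UNIV. ginv h x $ r $ r' * riemann_contra3 h r' a b c x)
     = \<kappa> * (ginv h x $ r $ b * ginv h x $ a $ c - ginv h x $ r $ c * ginv h x $ a $ b)" for r a b c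
    unfolding riemann_contra3_eq
    by (simp add: right_diff_distrib sum_subtractf mult.left_commute[of _ \<kappa>]
        if_distrib[of "\<lambda>z. _ * z"] flip: sum_distrib_left cong: if_cong)
  \<comment> \<open>Two antisymmetrised tensors multiply to four products, which coincide in pairs
    after reordering the factors; hence the \<open>2\<close>.\<close>
  have inner: "(\<Sum>c\<in>UNIV. \<Sum>d\<in>UNIV. riemann h a b c d x *
      (\<Sum>r'\<in>UNIV. ginv h x $ a $ r' * riemann_contra3 h r' b c d x)) = 2 * \<kappa>\<^sup>2 * 
      ((\<Sum>c\<in>UNIV. h x $ a $ c * ginv h x $ a $ c) * (\<Sum>d\<in>UNIV. h x $ b $ d * ginv h x $ b $ d)
      - (\<Sum>c\<in>UNIV. h x $ b $ c * ginv h x $ a $ c) * (\<Sum>d\<in>UNIV. h x $ a $ d * ginv h x $ b $ d))" for a b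
  proof -
    have "(\<Sum>c\<in>UNIV. \<Sum>d\<in>UNIV. riemann h a b c d x *
      (\<Sum>r'\<in>UNIV. ginv h x $ a $ r' * riemann_contra3 h r' b c d x))
      = \<kappa>\<^sup>2 * ((\<Sum>c\<in>UNIV. \<Sum>d\<in>UNIV. (h x $ a $ c * ginv h x $ a $ c) * (h x $ b $ d * ginv h x $ b $ d))
      + (\<Sum>c\<in>UNIV. \<Sum>d\<in>UNIV. (h x $ b $ c * ginv h x $ b $ c) * (h x $ a $ d * ginv h x $ a $ d))
      - (\<Sum>c\<in>UNIV. \<Sum>d\<in>UNIV. (h x $ b $ c * ginv h x $ a $ c) * (h x $ a $ d * ginv h x $ b $ d))
      - (\<Sum>c\<in>UNIV. \<Sum>d\<in>UNIV. (h x $ a $ c * ginv h x $ b $ c) * (h x $ b $ d * ginv h x $ a $ d)))"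
      unfolding c4 riem
      by (simp add: sum_distrib_left power2_eq_square algebra_simps flip: sum.distrib sum_subtractf)
    then show ?thesis unfolding sum_product[symmetric] by (simp add: algebra_simps)
  qed
  have 2: "(\<Sum>a\<in>UNIV. \<Sum>b\<in>UNIV. \<Sum>c\<in>UNIV. \<Sum>d\<in>UNIV. riemann h a b c d x *
      (\<Sum>r'\<in>UNIV. ginv h x $ a $ r' * riemann_contra3 h r' b c d x)) = 2 * \<kappa>\<^sup>2 * N * (N - 1)"
    unfolding inner contract
    by (simp add: sum_subtractf N algebra_simps if_distrib[of "\<lambda>z. _ * z"]
        flip: sum_distrib_left cong: if_cong)
  show ?thesis
    unfolding gauss_bonnet_def ricci_scalar_eq 1 2 by (simp add: algebra_simps power2_eq_square)
qed

text \<open>In units of \<open>\<kappa>\<^sup>2 * (N - 1) * (N - 2) * (N - 3)\<close> times the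
  metric, the doubled bracket of \<open>gb_tensor\<close> contributes \<open>2\<close> and the trace
  term \<open>- N / 2\<close>, which produces the factor \<open>N - 4\<close>.\<close>

lemma gb_tensor_eq:
  "gb_tensor h a b x = - (1/2) * \<kappa>\<^sup>2 * (N - 1) * (N - 2) * (N - 3) * (N - 4) * h x $ a $ b"
proof -
  have ric: "(\<Sum>c\<in>UNIV. \<Sum>d\<in>UNIV. ricci h a c x * ginv h x $ c $ d * ricci h d b x)
      = (\<kappa> * (N - 1))\<^sup>2 * h x $ a $ b"
  proof -
    have "(\<Sum>c\<in>UNIV. \<Sum>d\<in>UNIV. ricci h a c x * ginv h x $ c $ d * ricci h d b x)
      = (\<kappa> * (N - 1))\<^sup>2 * (\<Sum>c\<in>UNIV. h x $ a $ c * (\<Sum>d\<in>UNIV. ginv h x $ c $ d * h x $ d $ b))"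
      unfolding ricci_eq sum_distrib_left by (simp add: power2_eq_square mult_ac)
    then show ?thesis unfolding contract by (simp add: if_distrib[of "\<lambda>z. _ * z"] cong: if_cong)
  qed
  have ric_riem: "(\<Sum>c\<in>UNIV. \<Sum>d\<in>UNIV. ricci_contra h c d x * riemann h a c b d x)
      = \<kappa>\<^sup>2 * (N - 1)\<^sup>2 * h x $ a $ b"
  proof -
    have "(\<Sum>c\<in>UNIV. \<Sum>d\<in>UNIV. ricci_contra h c d x * riemann h a c b d x)
      = \<kappa>\<^sup>2 * (N - 1) * (h x $ a $ b * (\<Sum>c\<in>UNIV. \<Sum>d\<in>UNIV. h x $ c $ d * ginv h x $ c $ d)
         - (\<Sum>c\<in>UNIV. h x $ c $ b * (\<Sum>d\<in>UNIV. h x $ a $ d * ginv h x $ c $ d)))"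
      unfolding ricci_contra_eq riem
      by (simp add: sum_distrib_left power2_eq_square algebra_simps flip: sum.distrib sum_subtractf)
    then show ?thesis
      unfolding contract ginv_h_sum
      by (simp add: if_distrib[of "\<lambda>z. _ * z"] N[symmetric] algebra_simps power2_eq_square cong: if_cong)
  qed
  have riem2: "(\<Sum>c\<in>UNIV. \<Sum>d\<in>UNIV. \<Sum>e\<in>UNIV. riemann_contra3 h a c d e x * riemann h b c d e x)
      = 2 * \<kappa>\<^sup>2 * (N - 1) * h x $ a $ b"
  proof -
    have inner: "(\<Sum>d\<in>UNIV. \<Sum>e\<in>UNIV. riemann_contra3 h a c d e x * riemann h b c d e x)
      = 2 * \<kappa>\<^sup>2 * (h x $ a $ b * (\<Sum>e\<in>UNIV. h x $ c $ e * ginv h x $ c $ e)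
         - h x $ a $ c * (\<Sum>e\<in>UNIV. h x $ b $ e * ginv h x $ c $ e))" for c
    proof -
      have "(\<Sum>d\<in>UNIV. \<Sum>e\<in>UNIV. riemann_contra3 h a c d e x * riemann h b c d e x)
        = \<kappa>\<^sup>2 * (\<Sum>d\<in>UNIV. \<Sum>e\<in>UNIV. ((if a = d then ginv h x $ c $ e else 0) - (if a = e then ginv h x $ c $ d else 0))
            * (h x $ b $ d * h x $ c $ e - h x $ b $ e * h x $ c $ d))"
        unfolding riemann_contra3_eq riem sum_distrib_left power2_eq_square by (simp only: mult_ac)
      also have "\<dots> = \<kappa>\<^sup>2 * ((\<Sum>e\<in>UNIV. ginv h x $ c $ e * (h x $ b $ a * h x $ c $ e - h x $ b $ e * h x $ c $ a))
          - (\<Sum>d\<in>UNIV. ginv h x $ c $ d * (h x $ b $ d * h x $ c $ a - h x $ b $ a * h x $ c $ d)))"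
        unfolding sum_delta_antisym ..
      also have "\<dots> = 2 * \<kappa>\<^sup>2 * (h x $ a $ b * (\<Sum>e\<in>UNIV. h x $ c $ e * ginv h x $ c $ e)
         - h x $ a $ c * (\<Sum>e\<in>UNIV. h x $ b $ e * ginv h x $ c $ e))"
        by (simp add: sym[of a] sum_distrib_left algebra_simps sum_subtractf)
      finally show ?thesis .
    qed
    show ?thesis
      unfolding inner contract
      by (simp add: if_distrib[of "\<lambda>z. _ * z"] sum_subtractf N algebra_simps power2_eq_square
        flip: sum_distrib_left cong: if_cong)
  qed
  show ?thesis
    unfolding gb_tensor_def ric ric_riem riem2
    unfolding ricci_eq ricci_scalar_eq gauss_bonnet_eq
    by (simp add: field_simps power2_eq_square)
qed

lemma ginv_h_mixed: "(\<Sum>l\<in>UNIV. ginv h x $ a $ l * (p * h x $ l $ b)) = (if a = b then p else 0)"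
  using contract(2)[of a b] by (simp add: mult.left_commute flip: sum_distrib_left)

end

section \<open>Product metrics\<close>

text \<open>Blocks are functions of the indices rather than matrices, and nested for higher rank:
  once every index is split into \<open>Inl\<close> or \<open>Inr\<close>,
  \<open>block_simps\<close> evaluates any component.\<close>

definition block2 :: "('a \<Rightarrow> 'a \<Rightarrow> real) \<Rightarrow> ('b \<Rightarrow> 'b \<Rightarrow> real) \<Rightarrow> 'a + 'b \<Rightarrow> 'a + 'b \<Rightarrow> real" where
  "block2 F G m n = (case (m, n) of (Inl A, Inl B) \<Rightarrow> F A B | (Inr a, Inr b) \<Rightarrow> G a b | _ \<Rightarrow> 0)"

definition block3 :: "('a \<Rightarrow> 'a \<Rightarrow> 'a \<Rightarrow> real) \<Rightarrow> ('b \<Rightarrow> 'b \<Rightarrow> 'b \<Rightarrow> real) \<Rightarrow>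
    'a + 'b \<Rightarrow> 'a + 'b \<Rightarrow> 'a + 'b \<Rightarrow> real" where
  "block3 F G l m n = (case l of Inl A \<Rightarrow> block2 (F A) (\<lambda>_ _. 0) m n | Inr a \<Rightarrow> block2 (\<lambda>_ _. 0) (G a) m n)"

definition block4 :: "('a \<Rightarrow> 'a \<Rightarrow> 'a \<Rightarrow> 'a \<Rightarrow> real) \<Rightarrow> ('b \<Rightarrow> 'b \<Rightarrow> 'b \<Rightarrow> 'b \<Rightarrow> real) \<Rightarrow>
    'a + 'b \<Rightarrow> 'a + 'b \<Rightarrow> 'a + 'b \<Rightarrow> 'a + 'b \<Rightarrow> real" where
  "block4 F G k l m n =
     (case k of Inl A \<Rightarrow> block3 (F A) (\<lambda>_ _ _. 0) l m n | Inr a \<Rightarrow> block3 (\<lambda>_ _ _. 0) (G a) l m n)"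

lemma block_simps [simp]:
  "block2 F2 G2 (Inl A) (Inl B) = F2 A B" "block2 F2 G2 (Inr a) (Inr b) = G2 a b"
  "block2 F2 G2 (Inl A) (Inr b) = 0" "block2 F2 G2 (Inr a) (Inl B) = 0"
  "block3 F3 G3 (Inl A) = block2 (F3 A) (\<lambda>_ _. 0)" "block3 F3 G3 (Inr a) = block2 (\<lambda>_ _. 0) (G3 a)"
  "block4 F4 G4 (Inl A) = block3 (F4 A) (\<lambda>_ _ _. 0)" "block4 F4 G4 (Inr a) = block3 (\<lambda>_ _ _. 0) (G4 a)"
  by (simp_all add: block2_def block3_def block4_def fun_eq_iff)

lemma part_along_axis:
  "base_part (x + s *\<^sub>R axis (Inl A) 1) = base_part x + s *\<^sub>R axis A 1"
  "base_part (x + s *\<^sub>R axis (Inr a) 1) = base_part x"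
  "fibre_part (x + s *\<^sub>R axis (Inr a) 1) = fibre_part x + s *\<^sub>R axis a 1"
  "fibre_part (x + s *\<^sub>R axis (Inl A) 1) = fibre_part x"
  by (simp_all add: vec_eq_iff base_part_def fibre_part_def axis_def)

lemma partial_base_part:
  "partial (Inl A) (\<lambda>y. F (base_part y)) x = partial A F (base_part x)"
  "partial (Inr a) (\<lambda>y. F (base_part y)) x = 0"
  unfolding partial_def part_along_axis by simp_all

lemma partial_fibre_part:
  "partial (Inr a) (\<lambda>y. G (fibre_part y)) x = partial a G (fibre_part x)"
  "partial (Inl A) (\<lambda>y. G (fibre_part y)) x = 0"
  unfolding partial_def part_along_axis by simp_all

lemma partial_const: "partial i (\<lambda>y. c) x = 0"
  unfolding partial_def by simp

lemma product_metric_eq_block: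
  "product_metric g c \<gamma> x $ m $ n
     = block2 (\<lambda>A B. g (base_part x) $ A $ B) (\<lambda>a b. c * \<gamma> (fibre_part x) $ a $ b) m n"
  by (simp add: product_metric_def block2_def split: sum.split)

text \<open>Absorbs the squared radius into the fibre metric, so that the product computations carry
  no scale.\<close>

lemma product_metric_scaleR:
  "product_metric g c \<gamma> = product_metric g 1 (\<lambda>x. c *\<^sub>R \<gamma> x)"
  by (simp add: fun_eq_iff vec_eq_iff product_metric_eq_block)

lemma continuous_base_part: "continuous_on S base_part"
  unfolding base_part_def by (intro continuous_intros)

lemma continuous_fibre_part: "continuous_on S fibre_part"
  unfolding fibre_part_def by (intro continuous_intros)

locale metric_product =
  fixes g :: "'a::finite metric" and h :: "'b::finite metric" and V W
  assumes V: "open V" and W: "open W"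
    and inv_g: "y \<in> V \<Longrightarrow> invertible (g y)" and inv_h: "z \<in> W \<Longrightarrow> invertible (h z)"
begin

definition P :: "('a + 'b) metric" where "P = product_metric g 1 h"

definition S :: "(real^('a + 'b)) set" where "S = {x. base_part x \<in> V \<and> fibre_part x \<in> W}"

lemma S: "open S"
proof -
  have "S = base_part -` V \<inter> fibre_part -` W" by (auto simp: S_def)
  then show ?thesis
    using open_vimage[OF V continuous_base_part] open_vimage[OF W continuous_fibre_part] by auto
qed

lemma P_block: "P x $ m $ n = block2 (\<lambda>A B. g (base_part x) $ A $ B) (\<lambda>a b. h (fibre_part x) $ a $ b) m n"
  unfolding P_def product_metric_eq_block by simp

lemma ginv_block:
  assumes "x \<in> S"
  shows "ginv P x $ m $ n
    = block2 (\<lambda>A B. ginv g (base_part x) $ A $ B) (\<lambda>a b. ginv h (fibre_part x) $ a $ b) m n"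
proof -
  let ?Q = "\<chi> m n. block2 (\<lambda>A B. ginv g (base_part x) $ A $ B) (\<lambda>a b. ginv h (fibre_part x) $ a $ b) m n"
  have i: "invertible (g (base_part x))" "invertible (h (fibre_part x))"
    using assms inv_g inv_h by (auto simp: S_def)
  have "(P x ** ?Q) $ i $ j = mat 1 $ i $ j" for i j
    by (cases i; cases j)
       (simp_all add: matrix_matrix_mult_def P_block sum_UNIV_Plus matrix_inv_entries i mat_def)
  then have "P x ** ?Q = mat 1" by (simp add: vec_eq_iff)
  from matrix_inv_unique(2)[OF this] show ?thesis by simp
qed

lemma partial_P:
  "partial l (\<lambda>y. P y $ m $ n) x = block3
     (\<lambda>C A B. partial C (\<lambda>y. g y $ A $ B) (base_part x))
     (\<lambda>c a b. partial c (\<lambda>y. h y $ a $ b) (fibre_part x)) l m n"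
  unfolding P_block
  by (cases l; cases m; cases n)
     (simp_all add: partial_const partial_base_part[where F = "\<lambda>y. g y $ A $ B" for A B]
        partial_fibre_part[where G = "\<lambda>y. h y $ a $ b" for a b])

lemma christoffel_block:
  assumes "x \<in> S"
  shows "christoffel P l m n x = block3
     (\<lambda>A B C. christoffel g A B C (base_part x)) (\<lambda>a b c. christoffel h a b c (fibre_part x)) l m n"
  by (cases l; cases m; cases n)
     (simp_all add: christoffel_def partial_P ginv_block[OF assms] sum_UNIV_Plus)

lemma partial_christoffel_block:
  assumes "x \<in> S"
  shows "partial k (christoffel P l m n) x = block4
     (\<lambda>D A B C. partial D (christoffel g A B C) (base_part x))
     (\<lambda>d a b c. partial d (christoffel h a b c) (fibre_part x)) k l m n"
proof -
  have "partial k (christoffel P l m n) x = partial k (\<lambda>x. block3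
     (\<lambda>A B C. christoffel g A B C (base_part x)) (\<lambda>a b c. christoffel h a b c (fibre_part x)) l m n) x"
    by (rule partial_cong[OF S assms christoffel_block])
  then show ?thesis
    by (cases k; cases l; cases m; cases n)
       (simp_all add: partial_const partial_base_part[where F = "christoffel g A B C" for A B C]
        partial_fibre_part[where G = "christoffel h a b c" for a b c])
qed

lemma riemann_up_block:
  assumes "x \<in> S"
  shows "riemann_up P r s m n x = block4
     (\<lambda>A B C D. riemann_up g A B C D (base_part x)) (\<lambda>a b c d. riemann_up h a b c d (fibre_part x)) r s m n"
  by (cases r; cases s; cases m; cases n)
     (simp_all add: riemann_up_def christoffel_block[OF assms] partial_christoffel_block[OF assms] sum_UNIV_Plus)

lemma riemann_block:
  assumes "x \<in> S"
  shows "riemann P r s m n x = block4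
     (\<lambda>A B C D. riemann g A B C D (base_part x)) (\<lambda>a b c d. riemann h a b c d (fibre_part x)) r s m n"
  by (cases r; cases s; cases m; cases n)
     (simp_all add: riemann_def P_block riemann_up_block[OF assms] sum_UNIV_Plus)

lemma ricci_block:
  assumes "x \<in> S"
  shows "ricci P m n x = block2
     (\<lambda>A B. ricci g A B (base_part x)) (\<lambda>a b. ricci h a b (fibre_part x)) m n"
  by (cases m; cases n)
     (simp_all add: ricci_def riemann_up_block[OF assms] sum_UNIV_Plus)

lemma ricci_scalar_sum:
  assumes "x \<in> S"
  shows "ricci_scalar P x = ricci_scalar g (base_part x) + ricci_scalar h (fibre_part x)"
  by (simp add: ricci_scalar_def ricci_block[OF assms] ginv_block[OF assms] sum_UNIV_Plus)

lemma ricci_contra_block: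
  assumes "x \<in> S"
  shows "ricci_contra P m n x = block2
     (\<lambda>A B. ricci_contra g A B (base_part x)) (\<lambda>a b. ricci_contra h a b (fibre_part x)) m n"
  by (cases m; cases n)
     (simp_all add: ricci_contra_def ricci_block[OF assms] ginv_block[OF assms] sum_UNIV_Plus)

lemma riemann_contra3_block:
  assumes "x \<in> S"
  shows "riemann_contra3 P r s m n x = block4
     (\<lambda>A B C D. riemann_contra3 g A B C D (base_part x))
     (\<lambda>a b c d. riemann_contra3 h a b c d (fibre_part x)) r s m n"
  by (cases r; cases s; cases m; cases n)
     (simp_all add: riemann_contra3_def riemann_block[OF assms] ginv_block[OF assms] sum_UNIV_Plus)

text \<open>The cross term comes from the square of the Ricci scalar; the other two terms are sums
  over the blocks.\<close>

lemma gauss_bonnet_product: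
  assumes "x \<in> S"
  shows "gauss_bonnet P x = gauss_bonnet g (base_part x) + gauss_bonnet h (fibre_part x)
     + 2 * ricci_scalar g (base_part x) * ricci_scalar h (fibre_part x)"
  unfolding gauss_bonnet_def
  by (simp add: ricci_scalar_sum[OF assms] ricci_block[OF assms] ricci_contra_block[OF assms]
      riemann_block[OF assms] riemann_contra3_block[OF assms] ginv_block[OF assms]
      sum_UNIV_Plus power2_sum)

text \<open>The base enters only through its two scalars: contractions of Ricci and Riemann tensors
  with free fibre indices never reach a base index.\<close>

lemma gb_tensor_fibre:
  assumes "x \<in> S"
  shows "gb_tensor P (Inr a) (Inr b) x = gb_tensor h a b (fibre_part x)
     + 2 * ricci_scalar g (base_part x) * ricci h a b (fibre_part x)
     - (gauss_bonnet g (base_part x) / 2 + ricci_scalar g (base_part x) * ricci_scalar h (fibre_part x))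
       * h (fibre_part x) $ a $ b"
  unfolding gb_tensor_def gauss_bonnet_product[OF assms]
  by (simp add: ricci_scalar_sum[OF assms] ricci_block[OF assms] ricci_contra_block[OF assms]
      riemann_block[OF assms] riemann_contra3_block[OF assms] ginv_block[OF assms] P_block
      sum_UNIV_Plus algebra_simps)

lemma einstein_tensor_fibre:
  assumes "x \<in> S"
  shows "einstein_tensor P (Inr a) (Inr b) x = ricci h a b (fibre_part x)
     - (ricci_scalar g (base_part x) + ricci_scalar h (fibre_part x)) / 2 * h (fibre_part x) $ a $ b"
  unfolding einstein_tensor_def by (simp add: ricci_scalar_sum[OF assms] ricci_block[OF assms] P_block)

text \<open>With \<open>N = n - 4\<close> and \<kappa> equal to \<open>k / r\<^sub>0\<^sup>2\<close>
  this is the scalar expression for the fibre components. Each lowered component apart from the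
  \<Lambda> term is a multiple of the fibre metric, so raising an index leaves a Kronecker
  delta.\<close>

lemma field_tensor_fibre:
  assumes x: "x \<in> S" and "space_form_at h (fibre_part x) \<kappa> N"
  shows "field_tensor \<alpha> \<Lambda> P (Inr a) (Inr b) x = (if a = b then
      \<Lambda> - ricci_scalar g (base_part x) / 2 - (N - 1) * (N - 2) * \<kappa> / 2
      - \<alpha> * ((N - 1) * (N - 2) * \<kappa> * ricci_scalar g (base_part x) + gauss_bonnet g (base_part x) / 2
          + (N - 1) * (N - 2) * (N - 3) * (N - 4) * \<kappa>\<^sup>2 / 2)
    else 0)"
proof -
  interpret space_form_at h "fibre_part x" \<kappa> N by fact
  define p where "p = - ricci_scalar g (base_part x) / 2 - (N - 1) * (N - 2) * \<kappa> / 2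
      - \<alpha> * ((N - 1) * (N - 2) * \<kappa> * ricci_scalar g (base_part x) + gauss_bonnet g (base_part x) / 2
          + (N - 1) * (N - 2) * (N - 3) * (N - 4) * \<kappa>\<^sup>2 / 2)"
  have "einstein_tensor P (Inr l) (Inr b) x + \<alpha> * gb_tensor P (Inr l) (Inr b) x = p * h (fibre_part x) $ l $ b" for l
    unfolding einstein_tensor_fibre[OF x] gb_tensor_fibre[OF x] ricci_eq ricci_scalar_eq gb_tensor_eq p_def
    by (simp add: field_simps power2_eq_square)
  then have "field_tensor \<alpha> \<Lambda> P (Inr a) (Inr b) x = (if a = b then p else 0) + \<Lambda> * (if a = b then 1 else 0)"
    unfolding field_tensor_def by (simp add: sum_UNIV_Plus ginv_block[OF x] ginv_h_mixed)
  then show ?thesis by (simp add: p_def)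
qed

end

section \<open>The static metric\<close>

text \<open>Pointwise setting in which the curvature operator is diagonal on coordinate planes; for
  distinct indices \<open>K a b\<close> is the sectional curvature of their plane. Sums over four
  indices become sums over \<open>K\<close>.\<close>

locale diagonal_curvature_at =
  fixes g :: "'i::finite metric" and x :: "real^'i" and d :: "'i \<Rightarrow> real" and K :: "'i \<Rightarrow> 'i \<Rightarrow> real"
  assumes diag: "g x $ a $ b = (if a = b then d a else 0)" and d: "d a \<noteq> 0"
    and K_diag: "K a a = 0"
    and riem_up: "riemann_up g r s m n x
      = K r s * d s * ((if r = m \<and> s = n then 1 else 0) - (if r = n \<and> s = m then 1 else 0))"
begin

lemma ginv_diag: "ginv g x $ a $ b = (if a = b then 1 / d a else 0)"
proof -
  have "g x ** (\<chi> a b. if a = b then 1 / d a else 0) = mat 1"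
    by (simp add: vec_eq_iff matrix_matrix_mult_def diag mat_def d
        if_distrib[of "\<lambda>z. z * _"] cong: if_cong)
  from matrix_inv_unique(2)[OF this] show ?thesis by simp
qed

lemma riemann_diag: "riemann g r s m n x
    = K r s * d r * d s * ((if r = m \<and> s = n then 1 else 0) - (if r = n \<and> s = m then 1 else 0))"
proof -
  have "riemann g r s m n x = (\<Sum>l\<in>UNIV. if r = l then d r * riemann_up g r s m n x else 0)"
    unfolding riemann_def diag by (intro sum.cong) auto
  then show ?thesis by (simp add: riem_up)
qed

lemma ricci_diag: "ricci g m n x = (if m = n then d m * (\<Sum>a\<in>UNIV. K a m) else 0)"
proof -
  have "riemann_up g a m a n x = (if m = n then d m * K a m else 0)" for a
    unfolding riem_up by (cases "a = m"; cases "m = n"; simp only: K_diag simp_thms if_True if_False; simp)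
  then show ?thesis
    unfolding ricci_def by (simp add: sum_distrib_left)
qed

lemma sum_ginv: "(\<Sum>b\<in>UNIV. ginv g x $ a $ b * F b) = F a / d a"
proof -
  have "(\<Sum>b\<in>UNIV. ginv g x $ a $ b * F b) = (\<Sum>b\<in>UNIV. if a = b then F b / d a else 0)"
    unfolding ginv_diag by (intro sum.cong) auto
  then show ?thesis by simp
qed

lemma ricci_scalar_diag: "ricci_scalar g x = (\<Sum>m\<in>UNIV. \<Sum>a\<in>UNIV. K a m)"
  unfolding ricci_scalar_def sum_ginv by (simp add: ricci_diag d)

lemma ricci_contra_diag: "ricci_contra g m n x = (if m = n then (\<Sum>a\<in>UNIV. K a m) / d m else 0)"
  unfolding ricci_contra_def mult.assoc sum_distrib_left[symmetric] sum_ginv by (simp add: ricci_diag d)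

lemma riemann_contra3_diag:
  "riemann_contra3 g m a b c x = riemann g m a b c x / (d a * d b * d c)"
  unfolding riemann_contra3_def mult.assoc sum_distrib_left[symmetric] sum_ginv by (simp add: mult.commute)

lemma gauss_bonnet_diag:
  "gauss_bonnet g x = (\<Sum>m\<in>UNIV. \<Sum>a\<in>UNIV. K a m)\<^sup>2 - 4 * (\<Sum>m\<in>UNIV. (\<Sum>a\<in>UNIV. K a m)\<^sup>2)
     + 2 * (\<Sum>m\<in>UNIV. \<Sum>n\<in>UNIV. (K m n)\<^sup>2)"
proof -
  \<comment> \<open>Only \<open>(r, s) = (m, n)\<close> and \<open>(r, s) = (n, m)\<close> survive,
    each with the square of \<open>K m n\<close>; for \<open>m = n\<close> they would collide, but
    \<open>K m m\<close> is zero.\<close>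
  have "riemann g m n r s x * (\<Sum>m'\<in>UNIV. ginv g x $ m $ m' * riemann_contra3 g m' n r s x)
     = (if n = s then (if m = r then (K m n)\<^sup>2 else 0) else 0)
     + (if m = s then (if n = r then (K m n)\<^sup>2 else 0) else 0)" for m n r s
    using K_diag[of m] d[of m] d[of n]
    unfolding sum_ginv by (auto simp: riemann_contra3_diag riemann_diag power2_eq_square)
  then have "(\<Sum>m\<in>UNIV. \<Sum>n\<in>UNIV. \<Sum>r\<in>UNIV. \<Sum>s\<in>UNIV.
     riemann g m n r s x * (\<Sum>m'\<in>UNIV. ginv g x $ m $ m' * riemann_contra3 g m' n r s x))
     = 2 * (\<Sum>m\<in>UNIV. \<Sum>n\<in>UNIV. (K m n)\<^sup>2)"
    by (simp add: sum.distrib sum_distrib_left)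
  moreover have "(\<Sum>m\<in>UNIV. \<Sum>n\<in>UNIV. ricci g m n x * ricci_contra g m n x)
     = (\<Sum>m\<in>UNIV. (\<Sum>a\<in>UNIV. K a m)\<^sup>2)"
    by (simp add: ricci_diag ricci_contra_diag d power2_eq_square
        if_distrib[of "\<lambda>z. z * _"] cong: if_cong)
  ultimately show ?thesis
    unfolding gauss_bonnet_def ricci_scalar_diag by simp
qed

end

section \<open>The index type \<open>4\<close> and functions of r and theta\<close>

lemma four_eq_zero: "(4::4) = 0"
  by simp

text \<open>Arithmetic in the type \<open>4\<close> is modulo four: \<open>exhaust_4\<close> and
  \<open>sum_4\<close> list \<open>1\<close> to \<open>4\<close>, while the coordinates are numbered
  \<open>0\<close> to \<open>3\<close>.\<close>

lemma exhaust_4': "(i::4) = 0 \<or> i = 1 \<or> i = 2 \<or> i = 3"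
  using exhaust_4[of i] four_eq_zero by auto

lemma sum_4': "sum F (UNIV :: 4 set) = F 0 + F 1 + F 2 + F 3"
  using sum_4[of F] four_eq_zero by (simp add: add_ac)

lemma distinct_4:
  "(0::4) \<noteq> 1" "(0::4) \<noteq> 2" "(0::4) \<noteq> 3" "(1::4) \<noteq> 0" "(1::4) \<noteq> 2" "(1::4) \<noteq> 3"
  "(2::4) \<noteq> 0" "(2::4) \<noteq> 1" "(2::4) \<noteq> 3" "(3::4) \<noteq> 0" "(3::4) \<noteq> 1" "(3::4) \<noteq> 2"
  by simp_all

text \<open>All components of the static metric and its Christoffel symbols depend on r and theta
  alone, so their partial derivatives are ordinary ones.\<close>

lemma partial_radial_polar:
  fixes \<Phi> :: "real \<Rightarrow> real \<Rightarrow> real" and x :: "real^4"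
  assumes "((\<lambda>r. \<Phi> r (x $ 2)) has_real_derivative D1) (at (x $ 1))"
    and "((\<lambda>\<theta>. \<Phi> (x $ 1) \<theta>) has_real_derivative D2) (at (x $ 2))"
  shows "partial i (\<lambda>y. \<Phi> (y $ 1) (y $ 2)) x = (if i = 1 then D1 else if i = 2 then D2 else 0)"
proof -
  have "((\<lambda>s. \<Phi> ((x + s *\<^sub>R axis i 1) $ 1) ((x + s *\<^sub>R axis i 1) $ 2)) has_real_derivative
      (if i = 1 then D1 else if i = 2 then D2 else 0)) (at 0)"
    using exhaust_4'[of i] assms DERIV_shift[of "\<lambda>r. \<Phi> r (x $ 2)" D1 0 "x $ 1"]
      DERIV_shift[of "\<lambda>\<theta>. \<Phi> (x $ 1) \<theta>" D2 0 "x $ 2"]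
    by (auto simp: axis_def add.commute)
  then show ?thesis by (rule partial_eqI)
qed

text \<open>The derivatives are parameters, so that the locale serves both for \<open>deriv\<close>
  of a given solution and for derivatives obtained from the closed form. \<open>I\<close> is any
  open set of positive radii, since one instance is the set where the closed form is
  nonzero.\<close>

locale static_spacetime =
  fixes f f1 f2 :: "real \<Rightarrow> real" and I :: "real set"
  assumes I: "open I" "I \<subseteq> {0<..}"
    and f1: "r \<in> I \<Longrightarrow> (f has_real_derivative f1 r) (at r)"
    and f2: "r \<in> I \<Longrightarrow> (f1 has_real_derivative f2 r) (at r)"
    and nz: "r \<in> I \<Longrightarrow> f r \<noteq> 0"
begin

definition V :: "(real^4) set" where "V = {y. y $ 1 \<in> I \<and> 0 < y $ 2 \<and> y $ 2 < pi}"

lemma open_V: "open V"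
proof -
  have "V = (\<lambda>y. y $ 1) -` I \<inter> (\<lambda>y. y $ 2) -` {0<..<pi}" by (auto simp: V_def)
  then show ?thesis
    using I(1) by (auto intro!: open_Int open_vimage continuous_intros)
qed

lemma V_D:
  assumes "x \<in> V"
  shows "x $ 1 \<in> I" "x $ 1 > 0" "sin (x $ 2) > 0" "f (x $ 1) \<noteq> 0"
  using assms I(2) nz sin_gt_zero unfolding V_def by auto

abbreviation g where "g \<equiv> static_metric f"

text \<open>A function of two real numbers rather than of the point, the shape that
  \<open>partial_radial_polar\<close> expects; the table of symbols below has the same
  shape.\<close>

definition d :: "4 \<Rightarrow> real \<Rightarrow> real \<Rightarrow> real" where
  "d A r \<theta> = (if A = 0 then - f r else if A = 1 then 1 / f r else if A = 2 then r\<^sup>2 else r\<^sup>2 * (sin \<theta>)\<^sup>2)"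

definition d' :: "4 \<Rightarrow> 4 \<Rightarrow> real \<Rightarrow> real \<Rightarrow> real" where
  "d' i A r \<theta> =
    (if i = 1 then (if A = 0 then - f1 r else if A = 1 then - f1 r / (f r)\<^sup>2
        else if A = 2 then 2 * r else 2 * r * (sin \<theta>)\<^sup>2)
     else if i = 2 \<and> A = 3 then 2 * r\<^sup>2 * sin \<theta> * cos \<theta> else 0)"

lemma g_eq: "g x $ A $ B = (if A = B then d A (x $ 1) (x $ 2) else 0)"
  unfolding static_metric_def d_def by simp

lemma d_nz: "x \<in> V \<Longrightarrow> d A (x $ 1) (x $ 2) \<noteq> 0"
  using V_D[of x] unfolding d_def by auto

lemma ginv_eq: 
  assumes "x \<in> V"
  shows "invertible (g x)" "ginv g x $ A $ B = (if A = B then 1 / d A (x $ 1) (x $ 2) else 0)"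
proof -
  have *: "g x ** (\<chi> A B. if A = B then 1 / d A (x $ 1) (x $ 2) else 0) = mat 1"
    using d_nz[OF assms]
    by (simp add: vec_eq_iff matrix_matrix_mult_def g_eq mat_def
        if_distrib[of "\<lambda>z. z * _"] cong: if_cong)
  from matrix_inv_unique[OF *]
  show "invertible (g x)" "ginv g x $ A $ B = (if A = B then 1 / d A (x $ 1) (x $ 2) else 0)"
    by simp_all
qed

lemma partial_g:
  assumes "x \<in> V"
  shows "partial i (\<lambda>y. g y $ A $ B) x = (if A = B then d' i A (x $ 1) (x $ 2) else 0)"
proof -
  note x = V_D[OF assms]
  have "partial i (\<lambda>y. d A (y $ 1) (y $ 2)) x
     = (if i = 1 then d' 1 A (x $ 1) (x $ 2) else if i = 2 then d' 2 A (x $ 1) (x $ 2) else 0)"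
    using exhaust_4'[of A]
    by (intro partial_radial_polar; elim disjE; 
        simp add: d_def d'_def distinct_4 x;
        auto intro!: derivative_eq_intros f1 x simp: x power2_eq_square)
  then show ?thesis
    unfolding g_eq by (auto simp: partial_const d'_def)
qed

definition \<Gamma> :: "4 \<Rightarrow> 4 \<Rightarrow> 4 \<Rightarrow> real \<Rightarrow> real \<Rightarrow> real" where
  "\<Gamma> l m n r \<theta> =
    (if l = 0 then (if m = 0 \<and> n = 1 \<or> m = 1 \<and> n = 0 then f1 r / (2 * f r) else 0)
     else if l = 1 then
       (if m \<noteq> n then 0 else if m = 0 then f r * f1 r / 2 else if m = 1 then - (f1 r / (2 * f r))
        else if m = 2 then - (r * f r) else - (r * f r * (sin \<theta>)\<^sup>2))
     else if l = 2 then
       (if m = 1 \<and> n = 2 \<or> m = 2 \<and> n = 1 then 1 / r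
        else if m = 3 \<and> n = 3 then - (sin \<theta> * cos \<theta>) else 0)
     else
       (if m = 1 \<and> n = 3 \<or> m = 3 \<and> n = 1 then 1 / r
        else if m = 2 \<and> n = 3 \<or> m = 3 \<and> n = 2 then cos \<theta> / sin \<theta> else 0))"

definition \<Gamma>' :: "4 \<Rightarrow> 4 \<Rightarrow> 4 \<Rightarrow> 4 \<Rightarrow> real \<Rightarrow> real \<Rightarrow> real" where
  "\<Gamma>' i l m n r \<theta> =
    (if i = 1 then
      (if l = 0 then (if m = 0 \<and> n = 1 \<or> m = 1 \<and> n = 0 then (f2 r * f r - (f1 r)\<^sup>2) / (2 * (f r)\<^sup>2) else 0)
       else if l = 1 then
         (if m \<noteq> n then 0 else if m = 0 then ((f1 r)\<^sup>2 + f r * f2 r) / 2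
          else if m = 1 then - ((f2 r * f r - (f1 r)\<^sup>2) / (2 * (f r)\<^sup>2))
          else if m = 2 then - (f r + r * f1 r) else - ((f r + r * f1 r) * (sin \<theta>)\<^sup>2))
       else if l = 2 then
         (if m = 1 \<and> n = 2 \<or> m = 2 \<and> n = 1 then - (1 / r\<^sup>2) else 0)
       else
         (if m = 1 \<and> n = 3 \<or> m = 3 \<and> n = 1 then - (1 / r\<^sup>2) else 0))
     else if i = 2 then
       (if l = 1 then (if m = 3 \<and> n = 3 then - (2 * r * f r * sin \<theta> * cos \<theta>) else 0)
        else if l = 2 then (if m = 3 \<and> n = 3 then (sin \<theta>)\<^sup>2 - (cos \<theta>)\<^sup>2 else 0)
        else if l = 3 then (if m = 2 \<and> n = 3 \<or> m = 3 \<and> n = 2 then - (1 / (sin \<theta>)\<^sup>2) else 0)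
        else 0)
     else 0)"

lemma christoffel_static:
  assumes "x \<in> V"
  shows "christoffel g l m n x = \<Gamma> l m n (x $ 1) (x $ 2)"
proof -
  note x = V_D[OF assms]
  have 1: "christoffel g l m n x = 1 / 2 * (1 / d l (x $ 1) (x $ 2) *
      ((if l = n then d' m l (x $ 1) (x $ 2) else 0) + (if l = m then d' n l (x $ 1) (x $ 2) else 0)
       - (if m = n then d' l m (x $ 1) (x $ 2) else 0)))"
    unfolding christoffel_def ginv_eq[OF assms] partial_g[OF assms]
    by (simp add: if_distrib[of "\<lambda>z. z * _"] cong: if_cong)
  show ?thesis
    unfolding 1 using exhaust_4'[of l] exhaust_4'[of m] exhaust_4'[of n] x
    by (elim disjE; simp add: d_def d'_def \<Gamma>_def distinct_4 power2_eq_square)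
qed

lemma \<Gamma>_deriv:
  assumes "x \<in> V"
  shows "((\<lambda>r. \<Gamma> l m n r (x $ 2)) has_real_derivative \<Gamma>' 1 l m n (x $ 1) (x $ 2)) (at (x $ 1))"
    and "((\<lambda>\<theta>. \<Gamma> l m n (x $ 1) \<theta>) has_real_derivative \<Gamma>' 2 l m n (x $ 1) (x $ 2)) (at (x $ 2))"
proof -
  note x = V_D[OF assms]
  have s: "(cos (x $ 2))\<^sup>2 = 1 - (sin (x $ 2))\<^sup>2" by (rule cos_squared_eq)
  note d = f1[OF x(1)] f2[OF x(1)]
  \<comment> \<open>The facts \<open>e\<close> to \<open>e6\<close> differentiate the non-constant
    table entries in the exact form of both tables, so that \<open>intro all\<close> closes each
    index case.\<close>
  have e: "((\<lambda>r. f1 r / (2 * f r)) has_real_derivative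
      (f2 (x $ 1) * f (x $ 1) - (f1 (x $ 1))\<^sup>2) / (2 * (f (x $ 1))\<^sup>2)) (at (x $ 1))"
    using x by (auto intro!: derivative_eq_intros d simp: field_simps power2_eq_square)
  have e1: "((\<lambda>r. f r * f1 r / 2) has_real_derivative
      ((f1 (x $ 1))\<^sup>2 + f (x $ 1) * f2 (x $ 1)) / 2) (at (x $ 1))"
    using x by (auto intro!: derivative_eq_intros d simp: field_simps power2_eq_square)
  have e2: "((\<lambda>r. r * f r) has_real_derivative f (x $ 1) + x $ 1 * f1 (x $ 1)) (at (x $ 1))"
    using x by (auto intro!: derivative_eq_intros d)
  have e3: "((\<lambda>r. 1 / r) has_real_derivative - (1 / (x $ 1)\<^sup>2)) (at (x $ 1))"
    using x by (auto intro!: derivative_eq_intros simp: power2_eq_square)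
  have e4: "((\<lambda>\<theta>. cos \<theta> / sin \<theta>) has_real_derivative - (1 / (sin (x $ 2))\<^sup>2)) (at (x $ 2))"
  proof (rule DERIV_cong)
    show "((\<lambda>\<theta>. cos \<theta> / sin \<theta>) has_real_derivative
        ((- sin (x $ 2)) * sin (x $ 2) - cos (x $ 2) * cos (x $ 2)) / (sin (x $ 2) * sin (x $ 2))) (at (x $ 2))"
      using x by (intro DERIV_divide DERIV_sin DERIV_cos) simp
    have "(- sin (x $ 2)) * sin (x $ 2) - cos (x $ 2) * cos (x $ 2) = - 1"
      using s by (simp add: power2_eq_square)
    then show "((- sin (x $ 2)) * sin (x $ 2) - cos (x $ 2) * cos (x $ 2)) / (sin (x $ 2) * sin (x $ 2))
        = - (1 / (sin (x $ 2))\<^sup>2)"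
      by (simp add: power2_eq_square)
  qed
  have e5: "((\<lambda>\<theta>. sin \<theta> * cos \<theta>) has_real_derivative - ((sin (x $ 2))\<^sup>2 - (cos (x $ 2))\<^sup>2)) (at (x $ 2))"
    by (auto intro!: derivative_eq_intros simp: field_simps power2_eq_square)
  have e6: "((\<lambda>\<theta>. x $ 1 * f (x $ 1) * (sin \<theta>)\<^sup>2) has_real_derivative
      2 * x $ 1 * f (x $ 1) * sin (x $ 2) * cos (x $ 2)) (at (x $ 2))"
    by (auto intro!: derivative_eq_intros)
  note all = e e1 e2 e3 e4 DERIV_minus[OF e] DERIV_minus[OF e2] DERIV_minus[OF DERIV_cmult_right[OF e2]]
    DERIV_minus[OF e5, simplified] DERIV_minus[OF e6]
  show "((\<lambda>r. \<Gamma> l m n r (x $ 2)) has_real_derivative \<Gamma>' 1 l m n (x $ 1) (x $ 2)) (at (x $ 1))"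
    using exhaust_4'[of l] exhaust_4'[of m] exhaust_4'[of n]
    by (elim disjE; simp only: \<Gamma>_def \<Gamma>'_def distinct_4 simp_thms if_True if_False;
        intro all DERIV_const)
  show "((\<lambda>\<theta>. \<Gamma> l m n (x $ 1) \<theta>) has_real_derivative \<Gamma>' 2 l m n (x $ 1) (x $ 2)) (at (x $ 2))"
    using exhaust_4'[of l] exhaust_4'[of m] exhaust_4'[of n]
    by (elim disjE; simp only: \<Gamma>_def \<Gamma>'_def distinct_4 simp_thms if_True if_False;
        intro all DERIV_const)
qed

lemma partial_christoffel_static:
  assumes "x \<in> V"
  shows "partial i (christoffel g l m n) x = \<Gamma>' i l m n (x $ 1) (x $ 2)"
proof -
  have "partial i (christoffel g l m n) x = partial i (\<lambda>y. \<Gamma> l m n (y $ 1) (y $ 2)) x"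
    by (rule partial_cong[OF open_V assms christoffel_static])
  also have "\<dots> = \<Gamma>' i l m n (x $ 1) (x $ 2)"
    unfolding partial_radial_polar[OF \<Gamma>_deriv[OF assms]] by (simp add: \<Gamma>'_def)
  finally show ?thesis .
qed

text \<open>Sectional curvatures of the coordinate planes.\<close>

definition K :: "real \<Rightarrow> 4 \<Rightarrow> 4 \<Rightarrow> real" where
  "K r A B = (if A = B then 0
     else if A = 0 \<and> B = 1 \<or> A = 1 \<and> B = 0 then - (f2 r / 2)
     else if A = 2 \<and> B = 3 \<or> A = 3 \<and> B = 2 then (1 - f r) / r\<^sup>2
     else - (f1 r / (2 * r)))"

lemma riemann_up_static:
  assumes "x \<in> V"
  shows "riemann_up g A B C D x = K (x $ 1) A B * d B (x $ 1) (x $ 2) *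
     ((if A = C \<and> B = D then 1 else 0) - (if A = D \<and> B = C then 1 else 0))"
proof -
  note x = V_D[OF assms]
  have s: "cos (x $ 2) * cos (x $ 2) = 1 - sin (x $ 2) * sin (x $ 2)"
    using cos_squared_eq[of "x $ 2"] by (simp add: power2_eq_square)
  have nz: "x $ 1 \<noteq> 0" "sin (x $ 2) \<noteq> 0"
    using x by auto
  show ?thesis
    unfolding riemann_up_def partial_christoffel_static[OF assms] christoffel_static[OF assms] sum_4'
    using exhaust_4'[of A] exhaust_4'[of B] exhaust_4'[of C] exhaust_4'[of D]
    \<comment> \<open>All 256 index cases are computed. Vanishing products are cleared first, so
      that \<open>field_simps\<close> meets only a few terms in each.\<close>
    by (elim disjE; simp only: \<Gamma>'_def \<Gamma>_def K_def d_def distinct_4 simp_thms if_True if_False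
       mult_zero_left mult_zero_right add_0_left add_0_right diff_0_right diff_self mult_1_right;
       simp add: field_simps power2_eq_square s x nz)
qed

end

section \<open>The constraint as a second derivative\<close>

context static_spacetime
begin

lemma static_diagonal_curvature:
  "x \<in> V \<Longrightarrow> diagonal_curvature_at g x (\<lambda>A. d A (x $ 1) (x $ 2)) (K (x $ 1))"
  by unfold_locales (simp_all add: g_eq d_nz riemann_up_static, simp add: K_def)

lemma ricci_scalar_static:
  assumes "x \<in> V"
  shows "ricci_scalar g x = - f2 (x $ 1) - 4 * f1 (x $ 1) / x $ 1 + 2 * (1 - f (x $ 1)) / (x $ 1)\<^sup>2"
  unfolding diagonal_curvature_at.ricci_scalar_diag[OF static_diagonal_curvature[OF assms]] sum_4' K_def
  by (simp add: distinct_4)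

text \<open>In four dimensions the quadratic form in \<open>K\<close> collapses to products over
  complementary planes, 8 (K01 K23 + K02 K13 + K03 K12).\<close>

lemma gauss_bonnet_static:
  assumes "x \<in> V"
  shows "gauss_bonnet g x = 4 * ((f1 (x $ 1))\<^sup>2 - (1 - f (x $ 1)) * f2 (x $ 1)) / (x $ 1)\<^sup>2"
  unfolding diagonal_curvature_at.gauss_bonnet_diag[OF static_diagonal_curvature[OF assms]] sum_4' K_def
  using V_D[OF assms] by (simp add: distinct_4 field_simps power2_eq_square)

text \<open>The summands are second antiderivatives of three parts of the rescaled constraint: the
  Gauss-Bonnet scalar, the Ricci scalar with its effective coefficient \<open>2 / m\<close>, and the
  constant part, where \<open>r ^ 4\<close> integrates \<open>12 * r\<^sup>2\<close>. Here
  \<open>m\<close> is the fibre dimension.\<close>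

definition first_integral :: "real \<Rightarrow> real \<Rightarrow> real \<Rightarrow> real" where
  "first_integral \<alpha> m r = 2 * \<alpha> * (1 - f r)\<^sup>2 + 2 / m * r\<^sup>2 * (1 - f r)
     + (2 * m - 3) / (6 * \<alpha> * m\<^sup>2 * (m - 1)) * r ^ 4"

definition first_integral' :: "real \<Rightarrow> real \<Rightarrow> real \<Rightarrow> real" where
  "first_integral' \<alpha> m r = - 4 * \<alpha> * (1 - f r) * f1 r + 2 / m * (2 * r * (1 - f r) - r\<^sup>2 * f1 r)
     + (2 * m - 3) / (6 * \<alpha> * m\<^sup>2 * (m - 1)) * (4 * r ^ 3)"

definition first_integral'' :: "real \<Rightarrow> real \<Rightarrow> real \<Rightarrow> real" where
  "first_integral'' \<alpha> m r = 4 * \<alpha> * ((f1 r)\<^sup>2 - (1 - f r) * f2 r)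
     + 2 / m * (2 * (1 - f r) - 4 * r * f1 r - r\<^sup>2 * f2 r)
     + (2 * m - 3) / (6 * \<alpha> * m\<^sup>2 * (m - 1)) * (12 * r\<^sup>2)"

lemma first_integral_deriv:
  assumes "r \<in> I"
  shows "(first_integral \<alpha> m has_real_derivative first_integral' \<alpha> m r) (at r)"
    and "(first_integral' \<alpha> m has_real_derivative first_integral'' \<alpha> m r) (at r)"
proof -
  have "((\<lambda>r. 2 * \<alpha> * (1 - f r)\<^sup>2 + k * r\<^sup>2 * (1 - f r) + e * r ^ 4) has_real_derivative
    - 4 * \<alpha> * (1 - f r) * f1 r + k * (2 * r * (1 - f r) - r\<^sup>2 * f1 r) + e * (4 * r ^ 3)) (at r)" for k e
    by (auto intro!: derivative_eq_intros f1[OF assms] simp: algebra_simps)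
  then show "(first_integral \<alpha> m has_real_derivative first_integral' \<alpha> m r) (at r)"
    unfolding first_integral_def first_integral'_def .
  have "((\<lambda>r. - 4 * \<alpha> * (1 - f r) * f1 r + k * (2 * r * (1 - f r) - r\<^sup>2 * f1 r) + e * (4 * r ^ 3)) has_real_derivative
    4 * \<alpha> * ((f1 r)\<^sup>2 - (1 - f r) * f2 r) + k * (2 * (1 - f r) - 4 * r * f1 r - r\<^sup>2 * f2 r) + e * (12 * r\<^sup>2)) (at r)" for k e
    by (auto intro!: derivative_eq_intros f1[OF assms] f2[OF assms] simp: algebra_simps power2_eq_square)
  then show "(first_integral' \<alpha> m has_real_derivative first_integral'' \<alpha> m r) (at r)"
    unfolding first_integral'_def first_integral''_def .
qed

lemma fibre_constraint_iff:
  fixes \<gamma> :: "'m::finite metric"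
  assumes U: "open U" and \<gamma>: "riemannian_metric_on \<gamma> U" "constant_sectional_curvature_on (- 1) \<gamma> U"
    and m: "m = real CARD('m)" "m > 1" and \<alpha>: "\<alpha> > 0"
    and \<Lambda>: "\<Lambda> = - ((m\<^sup>2 + 3 * m - 6) / (8 * \<alpha> * m * (m - 1)))"
    and x: "x \<in> chart_domain I U"
  shows "fibre_constraint \<alpha> \<Lambda> (product_metric g (2 * \<alpha> * m * (m - 1)) \<gamma>) x
    \<longleftrightarrow> first_integral'' \<alpha> m (base_part x $ 1) = 0"
proof -
  define c where "c = 2 * \<alpha> * m * (m - 1)"
  define h where "h = (\<lambda>x. c *\<^sub>R \<gamma> x)"
  let ?r = "base_part x $ 1"
  have c: "c > 0" using m \<alpha> by (simp add: c_def)
  interpret \<gamma>: C2_metric \<gamma> U by (rule C2_metric_riemannian[OF U \<gamma>(1)])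
  interpret metric_product g h V U
    using U open_V ginv_eq(1) matrix_inv_scaleR(1)[OF \<gamma>.inv] c
    by unfold_locales (auto simp: h_def)
  have xV: "base_part x \<in> V" and xU: "fibre_part x \<in> U"
    using x by (auto simp: chart_domain_def V_def)
  then have xS: "x \<in> S" by (simp add: S_def)
  \<comment> \<open>Rescaling by \<open>c\<close> multiplies the lowered Riemann tensor by
    \<open>c\<close> and a product of two metric components by \<open>c\<^sup>2\<close>; curvature
    \<open>- 1\<close> therefore becomes \<open>- 1 / c\<close>.\<close>
  have sf: "space_form_at h (fibre_part x) (- 1 / c) m"
  proof
    show "transpose (h (fibre_part x)) = h (fibre_part x)"
      using \<gamma>.sym[OF xU] by (simp add: h_def transpose_def vec_eq_iff)
    show "invertible (h (fibre_part x))" by (rule inv_h[OF xU])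
    show "riemann h i j k l (fibre_part x) = - 1 / c * (h (fibre_part x) $ i $ k * h (fibre_part x) $ j $ l
        - h (fibre_part x) $ i $ l * h (fibre_part x) $ j $ k)" for i j k l
      using c unfolding h_def \<gamma>.riemann_scaleR[OF xU less_imp_neq[OF c, symmetric]]
        constant_curvature_riemann[OF \<gamma>.C2_metric_axioms \<gamma>(2) _ xU, simplified]
      by (simp add: field_simps)
  qed (rule m)
  define X where "X = \<Lambda> - ricci_scalar g (base_part x) / 2 - (m - 1) * (m - 2) * (- 1 / c) / 2
      - \<alpha> * ((m - 1) * (m - 2) * (- 1 / c) * ricci_scalar g (base_part x) + gauss_bonnet g (base_part x) / 2
          + (m - 1) * (m - 2) * (m - 3) * (m - 4) * (- 1 / c)\<^sup>2 / 2)"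
  have P: "product_metric g (2 * \<alpha> * m * (m - 1)) \<gamma> = P"
    unfolding P_def unfolding h_def c_def[symmetric] by (rule product_metric_scaleR)
  have "fibre_constraint \<alpha> \<Lambda> (product_metric g (2 * \<alpha> * m * (m - 1)) \<gamma>) x \<longleftrightarrow> X = 0"
    unfolding P fibre_constraint_def field_tensor_fibre[OF xS sf] X_def by auto
  also have "\<dots> \<longleftrightarrow> - 2 * ?r\<^sup>2 * X = 0"
    using V_D[OF xV] by simp
  also have "- 2 * ?r\<^sup>2 * X = first_integral'' \<alpha> m ?r"
  proof -
    let ?F = "f ?r" and ?F1 = "f1 ?r" and ?F2 = "f2 ?r"
    have nz: "m \<noteq> 0" "m \<noteq> 1" "\<alpha> \<noteq> 0" "?r \<noteq> 0"
      using m \<alpha> V_D[OF xV] by auto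
    have R: "?r\<^sup>2 * ricci_scalar g (base_part x) = 2 * (1 - ?F) - 4 * ?r * ?F1 - ?r\<^sup>2 * ?F2"
      unfolding ricci_scalar_static[OF xV] using nz by (simp add: field_simps power2_eq_square)
    have L: "?r\<^sup>2 * gauss_bonnet g (base_part x) = 4 * (?F1\<^sup>2 - (1 - ?F) * ?F2)"
      unfolding gauss_bonnet_static[OF xV] using nz by simp
    \<comment> \<open>The value of \<open>c\<close> turns the subtracted term into
      \<open>(m - 2) / m\<close>.\<close>
    have 1: "1 - 2 * \<alpha> * (m - 1) * (m - 2) / c = 2 / m"
      unfolding c_def using nz by (simp add: field_simps)
    define E where "E = (2 * m - 3) / (6 * \<alpha> * m\<^sup>2 * (m - 1))"
    \<comment> \<open>Over the common denominator \<open>4 * \<alpha> * m\<^sup>2 * (m - 1)\<close>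
      the cubic and quadratic terms in \<open>m\<close> cancel and \<open>8 * (2 * m - 3)\<close>
      remains; this fixes the coefficient of \<open>r ^ 4\<close>.\<close>
    have 2: "- 2 * \<Lambda> - (m - 1) * (m - 2) / c + \<alpha> * (m - 1) * (m - 2) * (m - 3) * (m - 4) / c\<^sup>2
        = E * 12"
    proof -
      have e1: "(m - 1) * (m - 2) / c = (m - 2) / (2 * \<alpha> * m)"
        unfolding c_def using nz by simp
      have e2: "\<alpha> * (m - 1) * (m - 2) * (m - 3) * (m - 4) / c\<^sup>2
          = (m - 2) * (m - 3) * (m - 4) / (4 * \<alpha> * m\<^sup>2 * (m - 1))"
        unfolding c_def using nz by (simp add: power2_eq_square) (simp only: mult_ac)
      show ?thesis
        unfolding e1 e2 \<Lambda> E_def using nz by (simp add: divide_simps) (simp add: algebra_simps power2_eq_square)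
    qed
    have "- 2 * ?r\<^sup>2 * X = ?r\<^sup>2 * (- 2 * \<Lambda> - (m - 1) * (m - 2) / c + \<alpha> * (m - 1) * (m - 2) * (m - 3) * (m - 4) / c\<^sup>2)
       + (1 - 2 * \<alpha> * (m - 1) * (m - 2) / c) * (?r\<^sup>2 * ricci_scalar g (base_part x))
       + \<alpha> * (?r\<^sup>2 * gauss_bonnet g (base_part x))"
      unfolding X_def using c by (simp add: field_simps)
    then show ?thesis
      unfolding first_integral''_def E_def[symmetric] 1 2 R L by (simp add: algebra_simps)
  qed
  finally show ?thesis .
qed

section \<open>Integrating the constraint\<close>

lemma first_integral_affine:
  assumes "convex I" "\<And>r. r \<in> I \<Longrightarrow> first_integral'' \<alpha> m r = 0"
  obtains A B where "\<And>r. r \<in> I \<Longrightarrow> first_integral \<alpha> m r = A + B * r"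
proof -
  obtain B where B: "\<And>r. r \<in> I \<Longrightarrow> first_integral' \<alpha> m r = B"
    using has_field_derivative_zero_constant[OF assms(1), of "first_integral' \<alpha> m"]
      first_integral_deriv(2) assms(2) has_field_derivative_at_within by metis
  have d: "((\<lambda>r. first_integral \<alpha> m r - B * r) has_real_derivative 0) (at r within I)" if "r \<in> I" for r
    using DERIV_diff[OF first_integral_deriv(1)[OF that, of \<alpha> m] DERIV_cmult_Id[of B r]] B[OF that]
    by (simp add: has_field_derivative_at_within)
  obtain A where A: "\<And>r. r \<in> I \<Longrightarrow> first_integral \<alpha> m r - B * r = A"
    using has_field_derivative_zero_constant[OF assms(1) d] by blast
  show ?thesis
  proof (rule that)
    show "first_integral \<alpha> m r = A + B * r" if "r \<in> I" for r
      using A[OF that] by simp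
  qed
qed

text \<open>Differentiating the affine identity twice is a local matter, so this direction also
  covers a disconnected \<open>I\<close>.\<close>

lemma affine_first_integral:
  assumes "\<And>r. r \<in> I \<Longrightarrow> first_integral \<alpha> m r = A + B * r" "r \<in> I"
  shows "first_integral'' \<alpha> m r = 0"
proof -
  have B: "first_integral' \<alpha> m r = B" if "r \<in> I" for r
  proof -
    have "(first_integral \<alpha> m has_real_derivative B) (at r)"
      by (rule has_field_derivative_transform_within_open[where f = "\<lambda>r. A + B * r" and S = I])
         (use I that assms in \<open>auto intro!: derivative_eq_intros\<close>)
    then show ?thesis using first_integral_deriv(1)[OF that] DERIV_unique by blast
  qed
  have "(first_integral' \<alpha> m has_real_derivative 0) (at r)"
    by (rule has_field_derivative_transform_within_open[where f = "\<lambda>r. B" and S = I])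
       (simp_all add: I(1) assms(2) B)
  from DERIV_unique[OF this first_integral_deriv(2)[OF assms(2)]] show ?thesis by simp
qed

text \<open>Completing the square: after division by \<open>2 * \<alpha>\<close> the linear term is
  \<open>2 * w * (1 - f r)\<close> with \<open>w = r\<^sup>2 / (2 * m * \<alpha>)\<close>, and
  adding \<open>w\<^sup>2\<close> supplies the leading \<open>1\<close> in
  \<open>braces\<close>.\<close>

lemma first_integral_iff_square:
  assumes n: "n \<ge> 6" and \<alpha>: "\<alpha> > 0" and r: "r > 0"
  shows "first_integral \<alpha> (real n - 4) r = - 2 * \<alpha> * q + 2 * sqrt \<alpha> * M * r
    \<longleftrightarrow> (f r - 1 - r\<^sup>2 / (2 * (real n - 4) * \<alpha>))\<^sup>2 = (r\<^sup>2 / (2 * (real n - 4) * \<alpha>))\<^sup>2 * braces n \<alpha> M q r"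
proof -
  define m where "m = real n - 4"
  have m: "m \<ge> 2" and nm: "real n = m + 4" using n by (auto simp: m_def)
  define w where "w = r\<^sup>2 / (2 * m * \<alpha>)"
  have pw: "\<alpha> powr (3/2) = \<alpha> * sqrt \<alpha>"
    using \<alpha> powr_add[of \<alpha> 1 "1/2"] by (simp add: powr_half_sqrt)
  have "(f r - 1 - w)\<^sup>2 - w\<^sup>2 * braces n \<alpha> M q r
     = (first_integral \<alpha> m r - (- 2 * \<alpha> * q + 2 * sqrt \<alpha> * M * r)) / (2 * \<alpha>)"
  proof -
    have nz: "m \<noteq> 0" "m \<noteq> 1" "\<alpha> \<noteq> 0" "r \<noteq> 0" using m \<alpha> r by auto
    have b: "braces n \<alpha> M q r = 1 - (2 * m - 3) / (3 * (m - 1)) + 4 * m\<^sup>2 * (\<alpha> * sqrt \<alpha>) * M / r ^ 3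
       - 4 * m\<^sup>2 * \<alpha>\<^sup>2 * q / r ^ 4"
      unfolding braces_def nm pw by simp
    have "w\<^sup>2 * ((2 * m - 3) / (3 * (m - 1))) = (2 * m - 3) / (6 * \<alpha> * m\<^sup>2 * (m - 1)) * r ^ 4 / (2 * \<alpha>)"
      "w\<^sup>2 * (4 * m\<^sup>2 * (\<alpha> * sqrt \<alpha>) * M / r ^ 3) = 2 * sqrt \<alpha> * M * r / (2 * \<alpha>)"
      "w\<^sup>2 * (4 * m\<^sup>2 * \<alpha>\<^sup>2 * q / r ^ 4) = 2 * \<alpha> * q / (2 * \<alpha>)"
      unfolding w_def using nz
      by (simp_all add: field_simps power2_eq_square power3_eq_cube power4_eq_xxxx)
    then have "w\<^sup>2 * braces n \<alpha> M q r = w\<^sup>2 - (2 * m - 3) / (6 * \<alpha> * m\<^sup>2 * (m - 1)) * r ^ 4 / (2 * \<alpha>)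
       + 2 * sqrt \<alpha> * M * r / (2 * \<alpha>) - 2 * \<alpha> * q / (2 * \<alpha>)"
      unfolding b by (simp add: distrib_left right_diff_distrib)
    moreover have "(f r - 1 - w)\<^sup>2 - w\<^sup>2 = (2 * \<alpha> * (1 - f r)\<^sup>2 + 2 / m * r\<^sup>2 * (1 - f r)) / (2 * \<alpha>)"
      unfolding w_def using nz by (simp add: field_simps power2_eq_square)
    ultimately show ?thesis
      unfolding first_integral_def by (simp add: add_divide_distrib diff_divide_distrib)
  qed
  then show ?thesis using \<alpha> unfolding m_def[symmetric] w_def[symmetric] by auto
qed

end

text \<open>\<open>sqrt\<close> is extended to negative arguments as an odd function, so the formula
  for \<open>y\<close> alone would not imply \<open>b \<ge> 0\<close>; it has to be stated beside
  it.\<close>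

lemma square_eq_iff_signed_sqrt:
  assumes w: "w > 0"
  shows "y\<^sup>2 = w\<^sup>2 * b \<longleftrightarrow> b \<ge> 0 \<and> (\<exists>\<sigma>\<in>{- 1, 1::real}. y = w * (\<sigma> * sqrt b))"
proof
  assume eq: "y\<^sup>2 = w\<^sup>2 * b"
  have b: "b \<ge> 0"
    using eq w by (metis zero_le_power2 zero_le_mult_iff zero_less_power2 less_irrefl not_less)
  then have "y\<^sup>2 = (w * sqrt b)\<^sup>2"
    using eq by (simp add: power_mult_distrib)
  then have "y = w * sqrt b \<or> y = - (w * sqrt b)"
    by (simp add: power2_eq_iff)
  with b show "b \<ge> 0 \<and> (\<exists>\<sigma>\<in>{- 1, 1::real}. y = w * (\<sigma> * sqrt b))" by auto
qed (auto simp: power_mult_distrib)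

text \<open>Strict positivity of \<open>braces\<close> keeps the square root away from its singular
  point. The derivatives only instantiate \<open>static_spacetime\<close>, so their formulas stay
  hidden.\<close>

lemma solution_twice_differentiable:
  assumes I: "\<And>r. r \<in> I \<Longrightarrow> r > 0 \<and> braces n \<alpha> M q r > 0"
  obtains f1 f2 where
    "\<And>r. r \<in> I \<Longrightarrow> (solution n \<alpha> M q \<sigma> has_real_derivative f1 r) (at r)"
    "\<And>r. r \<in> I \<Longrightarrow> (f1 has_real_derivative f2 r) (at r)"
proof -
  define C X Y k where "C = 1 - (2 * real n - 11) / (3 * (real n - 5))"
    and "X = 4 * (real n - 4)\<^sup>2 * (\<alpha> powr (3/2)) * M" and "Y = 4 * (real n - 4)\<^sup>2 * \<alpha>\<^sup>2 * q"
    and "k = 1 / (2 * (real n - 4) * \<alpha>)"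
  define b b1 b2 where "b = braces n \<alpha> M q" and "b1 r = - 3 * X / r ^ 4 + 4 * Y / r ^ 5"
    and "b2 r = 12 * X / r ^ 5 - 20 * Y / r ^ 6" for r
  define s s1 s2 where "s r = sqrt (b r)" and "s1 r = b1 r / (2 * s r)"
    and "s2 r = (b2 r * (2 * s r) - b1 r * (2 * s1 r)) / ((2 * s r) * (2 * s r))" for r
  have b_eq: "b = (\<lambda>r. C + X / r ^ 3 - Y / r ^ 4)"
    unfolding b_def braces_def C_def X_def Y_def by simp
  have sol: "solution n \<alpha> M q \<sigma> = (\<lambda>r. 1 + k * (r\<^sup>2 * (1 + \<sigma> * s r)))"
    unfolding solution_def s_def b_def k_def by (simp add: fun_eq_iff)
  define p1 p2 where "p1 r = k * (2 * r * (1 + \<sigma> * s r) + r\<^sup>2 * (\<sigma> * s1 r))"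
    and "p2 r = k * (2 * (1 + \<sigma> * s r) + 2 * r * (\<sigma> * s1 r) + (2 * r * (\<sigma> * s1 r) + r\<^sup>2 * (\<sigma> * s2 r)))" for r
  have "(solution n \<alpha> M q \<sigma> has_real_derivative p1 r) (at r)"
    and "(p1 has_real_derivative p2 r) (at r)" if "r \<in> I" for r
  proof -
    have r: "r > 0" "b r > 0" using I[OF that] by (auto simp: b_def)
    then have s: "s r > 0" by (simp add: s_def)
    have pow: "((\<lambda>r. a / r ^ Suc j) has_real_derivative - real (Suc j) * a / r ^ Suc (Suc j)) (at r)" for a j
    proof (rule DERIV_cong)
      show "((\<lambda>r. a / r ^ Suc j) has_real_derivative
          (0 * r ^ Suc j - a * (real (Suc j) * r ^ j)) / (r ^ Suc j * r ^ Suc j)) (at r)"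
        using r DERIV_pow[of "Suc j" r] by (intro DERIV_divide DERIV_const) simp_all
      show "(0 * r ^ Suc j - a * (real (Suc j) * r ^ j)) / (r ^ Suc j * r ^ Suc j)
          = - real (Suc j) * a / r ^ Suc (Suc j)"
        using r by (simp add: divide_simps) (simp add: algebra_simps)
    qed
    have db: "(b has_real_derivative b1 r) (at r)"
      unfolding b_eq b1_def using DERIV_diff[OF DERIV_add[OF DERIV_const[of C] pow[of X 2]] pow[of Y 3]]
      by (simp add: numeral_eq_Suc)
    have db1: "(b1 has_real_derivative b2 r) (at r)"
      unfolding b1_def b2_def using DERIV_add[OF pow[of "- 3 * X" 3] pow[of "4 * Y" 4]]
      by (simp add: numeral_eq_Suc)
    have ds: "(s has_real_derivative s1 r) (at r)"
      unfolding s_def s1_def using r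
      by (auto intro!: derivative_eq_intros db simp: divide_simps)
    have "((\<lambda>r. b1 r / (2 * s r)) has_real_derivative s2 r) (at r)"
      unfolding s2_def using s by (intro DERIV_divide db1 DERIV_cmult ds) auto
    then have ds1: "(s1 has_real_derivative s2 r) (at r)"
      by (simp add: s1_def[abs_def])
    show "(solution n \<alpha> M q \<sigma> has_real_derivative p1 r) (at r)"
      unfolding sol p1_def by (auto intro!: derivative_eq_intros ds simp: algebra_simps)
    show "(p1 has_real_derivative p2 r) (at r)"
      unfolding p1_def p2_def by (auto intro!: derivative_eq_intros ds ds1 simp: algebra_simps)
  qed
  then show ?thesis by (rule that)
qed

text \<open>In the converse the sign stands under the quantifier over \<open>r\<close>, because
  \<open>braces\<close> may vanish in \<open>I\<close> and the two branches meet at such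
  points.\<close>

theorem mainTheorem2:
  fixes n :: nat and \<alpha> \<Lambda> r\<^sub>0 :: real and I :: "real set"
    and U :: "(real^'m::finite) set" and \<gamma> :: "'m metric"
  assumes n: "n \<ge> 6" "CARD('m) = n - 4"
    and \<alpha>: "\<alpha> > 0"
    and r0: "r\<^sub>0\<^sup>2 = 2 * \<alpha> * (real n - 4) * (real n - 5)"
    and \<Lambda>: "\<Lambda> = - (((real n)\<^sup>2 - 5 * real n - 2) / (8 * \<alpha> * (real n - 4) * (real n - 5)))"
    and I: "open I" "is_interval I" "I \<subseteq> {0<..}"
    and U: "open U" "U \<noteq> {}"
    and \<gamma>: "riemannian_metric_on \<gamma> U" "constant_sectional_curvature_on (- 1) \<gamma> U"
  shows "(\<forall>M q. \<forall>\<sigma>\<in>{- 1, 1}. (\<forall>r\<in>I. braces n \<alpha> M q r > 0) \<longrightarrow>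
            (\<forall>x\<in>chart_domain I U. solution n \<alpha> M q \<sigma> (base_part x $ 1) \<noteq> 0 \<longrightarrow>
               fibre_constraint \<alpha> \<Lambda>
                 (product_metric (static_metric (solution n \<alpha> M q \<sigma>)) (r\<^sub>0\<^sup>2) \<gamma>) x))
       \<and> (\<forall>f. C2_real_on f I \<and> (\<forall>r\<in>I. f r \<noteq> 0) \<and>
            (\<forall>x\<in>chart_domain I U.
               fibre_constraint \<alpha> \<Lambda> (product_metric (static_metric f) (r\<^sub>0\<^sup>2) \<gamma>) x) \<longrightarrow>
            (\<exists>M q. \<forall>r\<in>I. braces n \<alpha> M q r \<ge> 0 \<and>
               (\<exists>\<sigma>\<in>{- 1, 1}. f r = solution n \<alpha> M q \<sigma> r)))"
proof (intro conjI allI ballI impI)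
  define m where "m = real n - 4"
  have m: "m = real CARD('m)" "m > 1" using n by (auto simp: m_def)
  have nm: "real n = m + 4" by (simp add: m_def)
  have c: "r\<^sub>0\<^sup>2 = 2 * \<alpha> * m * (m - 1)" using r0 by (simp add: m_def)
  have \<Lambda>_m: "\<Lambda> = - ((m\<^sup>2 + 3 * m - 6) / (8 * \<alpha> * m * (m - 1)))"
    unfolding \<Lambda> nm by (simp add: power2_eq_square algebra_simps)
  have w: "r\<^sup>2 / (2 * (real n - 4) * \<alpha>) > 0" if "r > 0" for r
    using that n(1) \<alpha> by simp
  \<comment> \<open>Used in both directions: it trades the square-root formula for an identity that
    is polynomial in \<open>f r\<close>.\<close>
  have square_iff: "(f r - 1 - r\<^sup>2 / (2 * (real n - 4) * \<alpha>))\<^sup>2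
        = (r\<^sup>2 / (2 * (real n - 4) * \<alpha>))\<^sup>2 * braces n \<alpha> M q r
      \<longleftrightarrow> braces n \<alpha> M q r \<ge> 0 \<and> (\<exists>\<sigma>\<in>{- 1, 1}. f r = solution n \<alpha> M q \<sigma> r)"
    if "r > 0" for f M q r
  proof -
    have "f r - 1 - w = w * (\<sigma> * s) \<longleftrightarrow> f r = 1 + w * (1 + \<sigma> * s)" for w \<sigma> s :: real
      by (auto simp: algebra_simps)
    then show ?thesis
      unfolding square_eq_iff_signed_sqrt[OF w[OF that]] solution_def by (simp only:)
  qed
  {
    fix M q \<sigma> x
    let ?f = "solution n \<alpha> M q \<sigma>"
    assume \<sigma>: "\<sigma> \<in> {- 1, 1 :: real}" and pos: "\<forall>r\<in>I. braces n \<alpha> M q r > 0"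
      and x: "x \<in> chart_domain I U" and sol_nz: "?f (base_part x $ 1) \<noteq> 0"
    \<comment> \<open>the metric exists only where the solution does not vanish\<close>
    define J where "J = {r \<in> I. ?f r \<noteq> 0}"
    obtain f1 f2 where f1: "\<And>r. r \<in> I \<Longrightarrow> (?f has_real_derivative f1 r) (at r)"
      and f2: "\<And>r. r \<in> I \<Longrightarrow> (f1 has_real_derivative f2 r) (at r)"
      using solution_twice_differentiable[of I n \<alpha> M q \<sigma>] pos I(3) by blast
    have "continuous_on I ?f"
      using f1 by (meson DERIV_isCont continuous_at_imp_continuous_on)
    then have "open (I \<inter> ?f -` (- {0}))"
      using I(1) by (intro continuous_open_preimage) auto
    moreover have "J = I \<inter> ?f -` (- {0})" by (auto simp: J_def)
    ultimately have "open J" by simp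
    interpret J: static_spacetime ?f f1 f2 J
      using \<open>open J\<close> I(3) f1 f2 by unfold_locales (auto simp: J_def)
    have xJ: "x \<in> chart_domain J U" and rJ: "base_part x $ 1 \<in> J"
      using x sol_nz by (auto simp: chart_domain_def J_def)
    \<comment> \<open>The closed form satisfies the squared relation by construction, hence has an
      affine first integral; its second derivative is never expanded.\<close>
    have "J.first_integral \<alpha> m r = - 2 * \<alpha> * q + 2 * sqrt \<alpha> * M * r" if "r \<in> J" for r
    proof -
      have r: "r \<in> I" "r > 0" using that I(3) by (auto simp: J_def)
      show ?thesis
        unfolding m_def J.first_integral_iff_square[OF n(1) \<alpha> r(2)] square_iff[OF r(2)]
        using pos r(1) \<sigma> by (auto intro: less_imp_le)
    qed
    from J.affine_first_integral[OF this rJ]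
    show "fibre_constraint \<alpha> \<Lambda> (product_metric (static_metric ?f) (r\<^sub>0\<^sup>2) \<gamma>) x"
      unfolding c using J.fibre_constraint_iff[OF U(1) \<gamma> m \<alpha> \<Lambda>_m xJ] by simp
  next
    fix f
    assume f: "C2_real_on f I \<and> (\<forall>r\<in>I. f r \<noteq> 0) \<and>
      (\<forall>x\<in>chart_domain I U. fibre_constraint \<alpha> \<Lambda> (product_metric (static_metric f) (r\<^sub>0\<^sup>2) \<gamma>) x)"
    have deriv: "(F has_real_derivative deriv F r) (at r)" if "F differentiable_on I" "r \<in> I" for F r
      using that I(1) by (simp add: differentiable_on_eq_differentiable_at real_differentiable_def)
        (metis DERIV_imp_deriv)
    interpret S: static_spacetime f "deriv f" "deriv (deriv f)" I
      using f I deriv unfolding C2_real_on_def by unfold_locales auto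
    have zero: "S.first_integral'' \<alpha> m r = 0" if r: "r \<in> I" for r
    proof -
      \<comment> \<open>The hypothesis speaks of chart points, so each radius is realised by one:
        theta is \<open>pi / 2\<close>, inside its open range, and the fibre point is any element of
        \<open>U\<close>.\<close>
      obtain z where z: "z \<in> U" using U(2) by blast
      define x :: "real^(4 + 'm)" where
        "x = (\<chi> i. case i of Inl A \<Rightarrow> if A = 1 then r else pi / 2 | Inr a \<Rightarrow> z $ a)"
      have b: "base_part x $ 1 = r" "base_part x $ 2 = pi / 2" "fibre_part x = z"
        by (simp_all add: x_def base_part_def fibre_part_def vec_eq_iff)
      have x: "x \<in> chart_domain I U"
        using r z by (simp add: chart_domain_def b)
      show ?thesis
        using S.fibre_constraint_iff[OF U(1) \<gamma> m \<alpha> \<Lambda>_m x] f x unfolding c b by blast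
    qed
    have "convex I" using I(2) by (simp add: is_interval_convex)
    then obtain A B where AB: "\<And>r. r \<in> I \<Longrightarrow> S.first_integral \<alpha> m r = A + B * r"
      using S.first_integral_affine[OF _ zero] by blast
    define q M where "q = - A / (2 * \<alpha>)" and "M = B / (2 * sqrt \<alpha>)"
    have qM: "- 2 * \<alpha> * q = A" "2 * sqrt \<alpha> * M = B"
      using \<alpha> by (simp_all add: q_def M_def)
    have "braces n \<alpha> M q r \<ge> 0 \<and> (\<exists>\<sigma>\<in>{- 1, 1}. f r = solution n \<alpha> M q \<sigma> r)" if r: "r \<in> I" for r
    proof -
      have "r > 0" using r I(3) by auto
      moreover have "S.first_integral \<alpha> (real n - 4) r = - 2 * \<alpha> * q + 2 * sqrt \<alpha> * M * r"
        using AB[OF r] unfolding qM m_def .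
      ultimately show ?thesis
        using S.first_integral_iff_square[OF n(1) \<alpha>] square_iff by blast
    qed
    then show "\<exists>M q. \<forall>r\<in>I. braces n \<alpha> M q r \<ge> 0 \<and>
        (\<exists>\<sigma>\<in>{- 1, 1}. f r = solution n \<alpha> M q \<sigma> r)"
      by blast
  }
qed

end
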